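(* Let $1\le k\le|V_I|$, let $p_j\to\infty$, and for each $j$ let $f_{k,p_j}$ be an eigenfunction of the $p_j$-Laplacian associated with the $k$-th variational eigenvalue $\lambda_k(\Delta_{p_j})$. If $\lim_{j\to\infty}\big(f_{k,p_j},\lambda_k(\Delta_{p_j})^{1/p_j}\big)=(f_k,\Lambda_k)$ with $f_k\neq0$, then $$\frac1{R_{\mathcal N(f_k)}}\le\Lambda_k\le\frac1{R_k},$$ where $\mathcal N(f_k)$ is the number of nodal domains induced by $f_k$.
   Context: $G=(V,E,\omega)$ is a finite undirected weighted graph: $E\subset V\times V$ is symmetric and $\omega_{uv}=\omega_{vu}>0$ for $(u,v)\in E$; $u\sim v$ means $(u,v)\in E$. $B\subset V$ (possibly empty) is the boundary and $V_I=V\setminus B\neq\emptyset$ the set of internal nodes. $G$ is connected: if $B=\emptyset$ any two nodes are joined by a path; if $B\ne\emptyset$ the subgraph induced by $V_I$ is connected and at least one internal node is adjacent to $B$. $\mathcal H_0(V)=\{f:V\to\mathbb R:\ f=0 \text{ on } B\}$. The nodal domains induced by $f$ are the maximal connected subgraphs on whose nodes $f$ is strictly positive or strictly negative. The length of a path $v_0\sim v_1\sim\dots\sim v_n$ is $\sum_{i=1}^n\omega_{v_{i-1}v_i}^{-1}$; $d(u,v)$ is the minimal length of a path joining $u$ and $v$ (so $d(u,u)=0$), and $d_B(u)=\min_{v\in B}d(u,v)$, with $d_B\equiv+\infty$ if $B=\emptyset$. The $m$-th packing radius is $R_m=\max\{r>0:\ \exists\,u_1,\dots,u_m\in V_I \text{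 with } d(u_i,u_j)\ge 2r \text{ for all } i\neq j \text{ and } d_B(u_i)\ge r \text{ for all } i\}$ (if $B=\emptyset$ and $m=1$, then $R_1=+\infty$ and $1/R_1=0$). For $p\in(1,\infty)$ and $f\in\mathcal H_0(V)$: $\nabla f(u,v)=\omega_{uv}(f(v)-f(u))$, $\|\nabla f\|_p^p=\frac12\sum_{(u,v)\in E}|\nabla f(u,v)|^p$, $\|f\|_p^p=\sum_{u\in V}|f(u)|^p$, $\mathcal R_p(f)=\|\nabla f\|_p/\|f\|_p$ for $f\ne0$, $S_p=\{f\in\mathcal H_0(V):\|f\|_p=1\}$, and $\Delta_pf(u)=\sum_{v\sim u}\omega_{uv}^p|f(u)-f(v)|^{p-2}(f(u)-f(v))$. The $k$-th variational eigenvalue is $\lambda_k(\Delta_p)=\min_{A\in\mathcal F_k(S_p)}\max_{f\in A}\mathcal R_p(f)^p$, where $\mathcal F_k(S_p)$ is the family of closed symmetric ($A=-A$) subsets of $S_p$ with Krasnoselskii genus at least $k$; the genus of a closed symmetric set $A$ is $0$ if $A=\emptyset$, otherwise the least $h\in\mathbb N$ for which there is a continuous odd map $A\to\mathbb R^h\setminus\{0\}$ ($\infty$ if there is none). An eigenfunction associated with $\lambda$ is $0\ne f\in\mathcal H_0(V)$ with $\Delta_pf(u)=\lambda|f(u)|^{p-2}f(u)$ for all $u\in V_I$. *)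

theory Defs
  imports "HOL-Analysis.Analysis"
begin

text \<open>
  The node set \<open>V\<close> is the finite type \<open>'v\<close>, so that \<open>\<real>\<^sup>V\<close> is \<open>real ^ 'v\<close>; the internal
  nodes are \<open>- B\<close>. Only the values of \<open>w\<close> on \<open>E\<close> matter below. Loops are not excluded.
\<close>

definition connected_on :: "('v \<times> 'v) set \<Rightarrow> 'v set \<Rightarrow> bool" where
  "connected_on E U \<longleftrightarrow> (\<forall>u\<in>U. \<forall>v\<in>U. (u, v) \<in> (E \<inter> U \<times> U)\<^sup>*)"

locale connected_weighted_graph =
  fixes E :: "('v::finite \<times> 'v) set" and w :: "'v \<Rightarrow> 'v \<Rightarrow> real" and B :: "'v set"
  assumes sym_E: "sym E"
    and w_sym: "(u, v) \<in> E \<Longrightarrow> w u v = w v u"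
    and w_pos: "(u, v) \<in> E \<Longrightarrow> w u v > 0"
    and internal_nonempty: "- B \<noteq> {}"
    and connected_no_boundary: "B = {} \<Longrightarrow> connected_on E UNIV"
    and connected_internal: "B \<noteq> {} \<Longrightarrow> connected_on E (- B)"
    and adjacent_boundary: "B \<noteq> {} \<Longrightarrow> \<exists>u\<in>- B. \<exists>v\<in>B. (u, v) \<in> E"

definition H0 :: "'v::finite set \<Rightarrow> (real ^ 'v) set" where
  "H0 B = {f. \<forall>u\<in>B. f $ u = 0}"


subsection \<open>Nodal domains\<close>

text \<open>A maximal connected subgraph is induced, hence is represented by its node set.\<close>

definition sign_connected :: "('v::finite \<times> 'v) set \<Rightarrow> real ^ 'v \<Rightarrow> 'v set \<Rightarrow> bool" where
  "sign_connected E f U \<longleftrightarrow>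
     U \<noteq> {} \<and> connected_on E U \<and> ((\<forall>u\<in>U. f $ u > 0) \<or> (\<forall>u\<in>U. f $ u < 0))"

definition nodal_domains :: "('v::finite \<times> 'v) set \<Rightarrow> real ^ 'v \<Rightarrow> 'v set set" where
  "nodal_domains E f =
     {U. sign_connected E f U \<and> (\<forall>W. sign_connected E f W \<and> U \<subseteq> W \<longrightarrow> W = U)}"


subsection \<open>Distance and packing radii\<close>

text \<open>
  Values are extended reals: \<open>d(u,v) = \<infinity>\<close> if no path joins \<open>u\<close> and \<open>v\<close>, \<open>d\<^sub>B = \<infinity>\<close> if
  \<open>B = {}\<close>, and \<open>R\<^sub>1 = \<infinity>\<close> (so \<open>1 / R\<^sub>1 = 0\<close>) if \<open>B = {}\<close>. Minima and maxima are written as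
  \<open>Inf\<close> and \<open>Sup\<close>.
\<close>

definition graph_dist ::
    "('v \<times> 'v) set \<Rightarrow> ('v \<Rightarrow> 'v \<Rightarrow> real) \<Rightarrow> 'v \<Rightarrow> 'v \<Rightarrow> ereal" where
  "graph_dist E w u v =
     Inf {ereal (\<Sum>i=1..n. inverse (w (x (i - 1)) (x i))) | (n::nat) x.
            x 0 = u \<and> x n = v \<and> (\<forall>i\<in>{1..n}. (x (i - 1), x i) \<in> E)}"

definition boundary_dist ::
    "('v \<times> 'v) set \<Rightarrow> ('v \<Rightarrow> 'v \<Rightarrow> real) \<Rightarrow> 'v set \<Rightarrow> 'v \<Rightarrow> ereal" where
  "boundary_dist E w B u = (INF v\<in>B. graph_dist E w u v)"

definition packing_radius ::
    "('v \<times> 'v) set \<Rightarrow> ('v \<Rightarrow> 'v \<Rightarrow> real) \<Rightarrow> 'v set \<Rightarrow> nat \<Rightarrow> ereal" where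
  "packing_radius E w B m =
     Sup {ereal r | r. r > 0 \<and>
            (\<exists>u :: nat \<Rightarrow> 'v.
               (\<forall>i\<in>{1..m}. u i \<in> - B) \<and>
               (\<forall>i\<in>{1..m}. \<forall>j\<in>{1..m}. i \<noteq> j \<longrightarrow> graph_dist E w (u i) (u j) \<ge> ereal (2 * r)) \<and>
               (\<forall>i\<in>{1..m}. boundary_dist E w B (u i) \<ge> ereal r))}"


subsection \<open>Krasnoselskii genus and variational eigenvalues\<close>

text \<open>
  For real arguments \<open>0 powr q = 0\<close> for every \<open>q\<close>, which agrees with the convention
  \<open>\<bar>0\<bar>\<^bsup>p-2\<^esup> 0 = 0\<close> for \<open>1 < p\<close>.
\<close>

definition grad_norm ::
    "('v::finite \<times> 'v) set \<Rightarrow> ('v \<Rightarrow> 'v \<Rightarrow> real) \<Rightarrow> real \<Rightarrow> real ^ 'v \<Rightarrow> real" where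
  "grad_norm E w p f =
     (1 / 2 * (\<Sum>(u, v)\<in>E. \<bar>w u v * (f $ v - f $ u)\<bar> powr p)) powr (1 / p)"

definition p_norm :: "real \<Rightarrow> real ^ 'v::finite \<Rightarrow> real" where
  "p_norm p f = (\<Sum>u\<in>UNIV. \<bar>f $ u\<bar> powr p) powr (1 / p)"

definition rayleigh ::
    "('v::finite \<times> 'v) set \<Rightarrow> ('v \<Rightarrow> 'v \<Rightarrow> real) \<Rightarrow> real \<Rightarrow> real ^ 'v \<Rightarrow> real" where
  "rayleigh E w p f = grad_norm E w p f / p_norm p f"

definition p_sphere :: "'v::finite set \<Rightarrow> real \<Rightarrow> (real ^ 'v) set" where
  "p_sphere B p = {f \<in> H0 B. p_norm p f = 1}"

text \<open>
  \<open>\<real>\<^sup>h\<close> is the library's \<open>Euclidean_space h\<close>, whose points are the sequences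
  \<open>nat \<Rightarrow> real\<close> vanishing from index \<open>h\<close> on. The infimum of the empty set is \<open>\<infinity>\<close>.
\<close>

definition genus :: "'a::real_normed_vector set \<Rightarrow> enat" where
  "genus A =
     (if A = {} then 0
      else Inf {enat h | h. \<exists>\<phi>.
             continuous_map (top_of_set A) (subtopology (Euclidean_space h) (- {\<lambda>_. 0})) \<phi> \<and>
             (\<forall>x\<in>A. \<phi> (- x) = (\<lambda>i. - \<phi> x i))})"

definition genus_family :: "nat \<Rightarrow> 'a::real_normed_vector set \<Rightarrow> 'a set set" where
  "genus_family k S = {A. A \<subseteq> S \<and> closed A \<and> uminus ` A = A \<and> genus A \<ge> enat k}"

text \<open>
  For \<open>1 \<le> k \<le> card (- B)\<close> the family is nonempty and its members are nonempty compact
  sets on which the quotient is continuous, so \<open>SUP\<close> is a maximum; \<open>INF\<close> renders the minimum.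
\<close>

definition variational_eigenvalue ::
    "('v::finite \<times> 'v) set \<Rightarrow> ('v \<Rightarrow> 'v \<Rightarrow> real) \<Rightarrow> 'v set \<Rightarrow> real \<Rightarrow> nat \<Rightarrow> real" where
  "variational_eigenvalue E w B p k =
     (INF A\<in>genus_family k (p_sphere B p). SUP f\<in>A. rayleigh E w p f powr p)"

definition p_laplacian ::
    "('v::finite \<times> 'v) set \<Rightarrow> ('v \<Rightarrow> 'v \<Rightarrow> real) \<Rightarrow> real \<Rightarrow> real ^ 'v \<Rightarrow> 'v \<Rightarrow> real" where
  "p_laplacian E w p f u =
     (\<Sum>v\<in>{v. (u, v) \<in> E}. w u v powr p * \<bar>f $ u - f $ v\<bar> powr (p - 2) * (f $ u - f $ v))"

definition eigenfunction ::
    "('v::finite \<times> 'v) set \<Rightarrow> ('v \<Rightarrow> 'v \<Rightarrow> real) \<Rightarrow> 'v set \<Rightarrow> real \<Rightarrow> real \<Rightarrow> real ^ 'v \<Rightarrow> bool" where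
  "eigenfunction E w B p l f \<longleftrightarrow>
     f \<noteq> 0 \<and> f \<in> H0 B \<and>
     (\<forall>u\<in>- B. p_laplacian E w p f u = l * \<bar>f $ u\<bar> powr (p - 2) * f $ u)"

end

theory Submission
  imports Defs "HOL-Homology.Homology"
begin

text \<open>
  Write \<open>\<lambda>\<^sub>p\<close> for the \<open>k\<close>-th variational eigenvalue. As \<open>p \<rightarrow> \<infinity>\<close> the quotient of \<open>p\<close>-norms turns into the
  quotient of maximum norms, and the largest edge difference \<open>w u v * \<bar>f v - f u\<bar>\<close> is the
  Lipschitz constant of \<open>f\<close> for the path distance. Both inequalities compare a Lipschitz constant
  with distances between well chosen nodes.

  Upper bound. Around the centres of a packing of radius \<open>r\<close> put tents, that is, the functions
  \<open>max 0 (r - d(u\<^sub>i, _))\<close>. Since the centres are \<open>2r\<close> apart, the supports of the tents are disjoint,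
  and for an edge between two different tents the triangle inequality bounds the sum of the two
  heights by the length of the edge. Hence every combination with coefficients bounded by \<open>M\<close> has
  edge differences at most \<open>M\<close>, while its maximum is \<open>r\<close> times the largest coefficient. The unit
  sphere of the span of the tents is therefore an admissible set on which the \<open>p\<close>-th power of the
  quotient is at most \<open>card E / 2 * (1/r) powr p\<close>; taking \<open>p\<close>-th roots and \<open>p \<rightarrow> \<infinity>\<close> gives
  \<open>\<Lambda> \<le> 1/r\<close>. That this sphere has genus at least \<open>k\<close> is the Borsuk-Ulam theorem. It follows from the
  theorem that an odd self-map of a sphere has odd degree (\<open>odd_Brouwer_degree2_odd_map\<close>),
  because a map into a smaller sphere is not surjective and so has degree \<open>0\<close>.

  Lower bound. Let \<open>f\<close> be the limit of the eigenfunctions \<open>f\<^sub>j\<close>, and rescale \<open>f\<close> on each of its nodal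
  domains so that its maximum modulus there is \<open>1\<close>; call the result \<open>g\<close>. Rescaling an eigenfunction
  by constants on its nodal domains does not raise the quotient above the eigenvalue, by convexity
  of \<open>t powr p\<close> along the edges on which the sign changes. The nodal domains of \<open>f\<^sub>j\<close> need not be those
  of \<open>f\<close>, since \<open>f\<^sub>j\<close> may be nonzero where \<open>f\<close> vanishes; but there \<open>f\<^sub>j\<close> is small compared with its values
  on the nodal domains of \<open>f\<close>, so the inequality survives with a factor \<open>C powr p\<close> for any \<open>C > 1\<close>, which
  is harmless after the \<open>p\<close>-th root. In the limit \<open>g\<close> has edge differences at most \<open>\<Lambda>\<close>
  (\<open>limit_gradient_bound\<close>). In each nodal domain choose a node with \<open>\<bar>g\<bar> = 1\<close>. A path from one of
  these nodes to the boundary must bring \<open>g\<close> to \<open>0\<close>, and a path to another one must bring \<open>g\<close> to \<open>0\<close> or to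
  the opposite sign and then back to modulus \<open>1\<close>. So these paths have length at least \<open>1/\<Lambda>\<close> and
  \<open>2/\<Lambda>\<close>, and the chosen nodes form a packing of radius \<open>1/\<Lambda>\<close>.
\<close>

section \<open>Odd maps between spheres\<close>

lemma topspace_nsphere: "topspace (nsphere n) = {x. (\<Sum>i\<le>n. (x i)\<^sup>2) = 1 \<and> (\<forall>i>n. x i = 0)}"
  by (simp add: nsphere)

text \<open>Through this identity continuity of maps between spheres can be shown with \<open>continuous_on\<close>.\<close>
lemma nsphere_eq_top_of_set: "nsphere n = top_of_set (topspace (nsphere n))"
  by (simp add: nsphere euclidean_product_topology)

lemma continuous_map_nsphere_iff:
  "continuous_map (nsphere n) (nsphere m) f \<longleftrightarrow>
     continuous_on (topspace (nsphere n)) f \<and> f \<in> topspace (nsphere n) \<rightarrow> topspace (nsphere m)"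
  by (metis continuous_map_iff_continuous continuous_map_in_subtopology nsphere_eq_top_of_set
      image_subset_iff_funcset topspace_euclidean_subtopology)

definition nsphere_proj :: "nat \<Rightarrow> (nat \<Rightarrow> real) \<Rightarrow> nat \<Rightarrow> real" where
  "nsphere_proj n x = (\<lambda>i. x i / sqrt (\<Sum>j\<le>n. (x j)\<^sup>2))"

definition punctured_space :: "nat \<Rightarrow> (nat \<Rightarrow> real) set" where
  "punctured_space n = {x. \<forall>i\<ge>n. x i = 0} - {\<lambda>_. 0}"

lemma sum_squares_punctured:
  assumes "x \<in> punctured_space (Suc n)"
  shows "(\<Sum>i\<le>n. (x i)\<^sup>2) > 0"
proof -
  from assms have x: "\<forall>i\<ge>Suc n. x i = 0" "x \<noteq> (\<lambda>_. 0)"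
    by (auto simp: punctured_space_def)
  then obtain i where i: "x i \<noteq> 0" by auto
  with x have "i \<le> n" using not_less_eq_eq by blast
  with i show ?thesis
    by (intro sum_pos2[of _ i]) auto
qed

lemma nsphere_subset_punctured: "topspace (nsphere n) \<subseteq> punctured_space (Suc n)"
  by (auto simp: topspace_nsphere punctured_space_def)

lemma nsphere_proj_in_nsphere:
  assumes "x \<in> punctured_space (Suc n)"
  shows "nsphere_proj n x \<in> topspace (nsphere n)"
  using sum_squares_punctured[OF assms] assms
  by (auto simp: nsphere_proj_def topspace_nsphere power_divide punctured_space_def
      simp flip: sum_divide_distrib)

lemma nsphere_proj_nsphere: "x \<in> topspace (nsphere n) \<Longrightarrow> nsphere_proj n x = x"
  by (simp add: nsphere_proj_def topspace_nsphere)

lemma nsphere_proj_minus: "nsphere_proj n (\<lambda>i. - x i) = (\<lambda>i. - nsphere_proj n x i)"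
  by (simp add: nsphere_proj_def)

lemma continuous_on_nsphere_proj:
  assumes "continuous_on S f" "f ` S \<subseteq> punctured_space (Suc n)"
  shows "continuous_on S (\<lambda>x. nsphere_proj n (f x))"
proof (rule continuous_on_coordinatewise_then_product)
  have pos: "(\<Sum>j\<le>n. (f x j)\<^sup>2) > 0" if "x \<in> S" for x
    using assms(2) that by (intro sum_squares_punctured) auto
  show "continuous_on S (\<lambda>x. nsphere_proj n (f x) i)" for i
    unfolding nsphere_proj_def
    by (intro continuous_intros continuous_on_product_then_coordinatewise[OF assms(1)])
       (use pos in force)
qed

text \<open>
  All homotopies below are given by elementary formulas that leave the sphere; it is enough that
  they avoid the origin.
\<close>
lemma Brouwer_degree2_proj_homotopy:
  assumes cont: "continuous_on ({0..1} \<times> topspace (nsphere n)) F"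
    and im: "F ` ({0..1::real} \<times> topspace (nsphere n)) \<subseteq> punctured_space (Suc n)"
  shows "Brouwer_degree2 n (\<lambda>x. nsphere_proj n (F (0, x))) = Brouwer_degree2 n (\<lambda>x. nsphere_proj n (F (1, x)))"
proof (rule Brouwer_degree2_homotopic)
  have "continuous_map (top_of_set ({0..1::real} \<times> topspace (nsphere n))) (top_of_set (topspace (nsphere n)))
     (\<lambda>z. nsphere_proj n (F z))"
    using continuous_on_nsphere_proj[OF cont im] im
    by (auto simp: continuous_map_in_subtopology intro!: nsphere_proj_in_nsphere)
  then have "continuous_map (prod_topology (top_of_set {0..1::real}) (nsphere n)) (nsphere n)
     (\<lambda>z. nsphere_proj n (F z))"
    by (metis nsphere_eq_top_of_set prod_topology_subtopology_eu)
  then show "homotopic_with (\<lambda>x. True) (nsphere n) (nsphere n) (\<lambda>x. nsphere_proj n (F (0, x))) (\<lambda>x. nsphere_proj n (F (1, x)))"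
    by (subst homotopic_with) auto
qed


text \<open>
  An odd self-map \<open>f\<close> of the \<open>n\<close>-sphere is close to an odd map \<open>g\<close> whose restriction to the equator
  misses two antipodal directions \<open>\<plusminus>a\<close>: take the odd part of a polynomial approximation. Its
  restriction to the lower-dimensional equator is differentiable, so the normalized image cannot
  fill the sphere. The polynomials live on a Euclidean space type of dimension \<open>N > n\<close>, into which the
  sequence spaces are embedded by \<open>T\<close>, with inverse \<open>U\<close>; this is the reason for the bound on \<open>n\<close>.
\<close>
lemma odd_map_approximation:
  fixes f :: "(nat \<Rightarrow> real) \<Rightarrow> nat \<Rightarrow> real"
  assumes n: "Suc m < DIM('a::euclidean_space)" and n_def: "n = Suc m"
    and cont: "continuous_on (topspace (nsphere n)) f"
    and im: "\<And>x. x \<in> topspace (nsphere n) \<Longrightarrow> f x \<in> topspace (nsphere n)"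
    and odd: "\<And>x. x \<in> topspace (nsphere n) \<Longrightarrow> f (\<lambda>i. - x i) = (\<lambda>i. - f x i)"
  obtains g a where "continuous_on (topspace (nsphere n)) g"
    "\<And>x i. x \<in> topspace (nsphere n) \<Longrightarrow> i > n \<Longrightarrow> g x i = 0"
    "\<And>x. x \<in> topspace (nsphere n) \<Longrightarrow> g (\<lambda>i. - x i) = (\<lambda>i. - g x i)"
    "\<And>x. x \<in> topspace (nsphere n) \<Longrightarrow> (\<Sum>i\<le>n. (f x i - g x i)\<^sup>2) < 1"
    "a \<in> topspace (nsphere n)"
    "\<And>x c. x \<in> topspace (nsphere m) \<Longrightarrow> g x \<noteq> (\<lambda>i. c * a i)"
proof -
  define N where "N = DIM('a)"
  have nN: "Suc n \<le> N" using n by (simp add: N_def n_def)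
  obtain b :: "nat \<Rightarrow> 'a" where b: "bij_betw b {..<N} Basis"
    using ex_bij_betw_nat_finite[OF finite_Basis] by (auto simp: N_def atLeast0LessThan)
  have inj: "inj_on b {..<N}" and bB: "\<And>i. i < N \<Longrightarrow> b i \<in> Basis"
    using b by (auto simp: bij_betw_def)
  have bb: "b i \<bullet> b j = (if i = j then 1 else 0)" if "i < N" "j < N" for i j
    using that inj bB by (auto simp: inner_Basis inj_on_def)
  have all_Basis: "(\<forall>v\<in>Basis. P v) \<longleftrightarrow> (\<forall>i<N. P (b i))" for P
    unfolding bij_betw_imp_surj_on[OF b, symmetric] by blast
  define T where "T = (\<lambda>x. \<Sum>i<N. x i *\<^sub>R b i)"
  define U where "U = (\<lambda>y i. if i < N then y \<bullet> b i else 0)"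
  have T_inner: "T x \<bullet> b i = x i" if "i < N" for x i
    using that by (simp add: T_def inner_sum_left bb if_distrib cong: if_cong)
  have TU: "T (U y) = y" for y
  proof -
    have "\<forall>v\<in>Basis. T (U y) \<bullet> v = y \<bullet> v"
      unfolding all_Basis by (simp add: T_inner U_def)
    then show ?thesis using euclidean_eq_iff by blast
  qed
  have T_norm: "(norm (T x))\<^sup>2 = (\<Sum>i<N. (x i)\<^sup>2)" for x
  proof -
    have "(norm (T x))\<^sup>2 = T x \<bullet> (\<Sum>i<N. x i *\<^sub>R b i)"
      unfolding power2_norm_eq_inner by (simp only: T_def)
    also have "\<dots> = (\<Sum>i<N. x i * (T x \<bullet> b i))"
      by (simp only: inner_sum_right inner_scaleR_right)
    also have "\<dots> = (\<Sum>i<N. (x i)\<^sup>2)"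
      by (rule sum.cong) (auto simp: T_inner power2_eq_square)
    finally show ?thesis .
  qed
  \<comment> \<open>\<open>W k\<close> is the span of the first \<open>k\<close> basis vectors.\<close>
  define W where "W = (\<lambda>k. {y::'a. \<forall>i<N. k \<le> i \<longrightarrow> y \<bullet> b i = 0})"
  have W_sub: "subspace (W k)" for k
    by (auto simp: W_def subspace_def inner_add_left)
  have W_mono: "W m' \<subseteq> W k" if "m' \<le> k" for m' k
    using that by (auto simp: W_def)
  have W_dim: "dim (W k) = k" if "k \<le> N" for k
  proof -
    have "W k = {y. \<forall>v\<in>Basis. v \<notin> b ` {..<k} \<longrightarrow> y \<bullet> v = 0}"
      unfolding W_def all_Basis using inj that
      by (auto simp: inj_on_image_mem_iff not_less)
    moreover have "card (b ` {..<k}) = k"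
      using that inj by (subst card_image) (auto intro: inj_on_subset)
    moreover have "b ` {..<k} \<subseteq> Basis"
      using that bB by auto
    ultimately show ?thesis
      using dim_substandard[of "b ` {..<k}"] by simp
  qed
  have sum_trunc: "(\<Sum>i<N. (x i)\<^sup>2) = (\<Sum>i\<le>k. (x i)\<^sup>2)" if "Suc k \<le> N" "\<forall>i>k. x i = 0"
    for x :: "nat \<Rightarrow> real" and k
    by (rule sum.mono_neutral_right) (use that in auto)
  have T_sphere: "T x \<in> sphere 0 1 \<inter> W (Suc k)" if "x \<in> topspace (nsphere k)" "Suc k \<le> N" for x k
  proof -
    have "(norm (T x))\<^sup>2 = 1"
      using that sum_trunc[of k x] by (simp add: T_norm topspace_nsphere)
    then have "norm (T x) = 1"
      by (simp add: power2_eq_1_iff) (metis norm_ge_zero not_one_le_zero neg_0_le_iff_le)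
    moreover have "T x \<in> W (Suc k)"
      using that by (auto simp: W_def T_inner topspace_nsphere)
    ultimately show ?thesis by simp
  qed
  have UT: "U (T x) = x" if "\<forall>i>k. x i = 0" "Suc k \<le> N" for x k
    using that by (auto simp: U_def T_inner fun_eq_iff)
  have U_W: "\<forall>i>k. U y i = 0" if "y \<in> W (Suc k)" for y k
    using that by (auto simp: U_def W_def)
  have U_sphere: "U y \<in> topspace (nsphere k)" if "y \<in> sphere 0 1 \<inter> W (Suc k)" "Suc k \<le> N" for y k
  proof -
    have "(\<Sum>i\<le>k. (U y i)\<^sup>2) = (norm y)\<^sup>2"
      using T_norm[of "U y"] sum_trunc[of k "U y"] U_W[of y k] that by (simp add: TU)
    then show ?thesis using that U_W[of y k] by (simp add: topspace_nsphere)
  qed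
  have T_minus: "T (\<lambda>i. - x i) = - T x" for x
    by (simp add: T_def sum_negf)
  have U_minus: "U (- y) = (\<lambda>i. - U y i)" for y
    by (auto simp: U_def fun_eq_iff)
  have T_diff: "T (\<lambda>i. x i - z i) = T x - T z" for x z
    by (simp add: T_def sum_subtractf scaleR_left_diff_distrib)
  have cT: "continuous_on S T" for S
    unfolding T_def by (intro continuous_intros continuous_on_product_then_coordinatewise[OF continuous_on_id])
  have cU: "continuous_on S U" for S
  proof (rule continuous_on_coordinatewise_then_product)
    show "continuous_on S (\<lambda>y. U y i)" for i
      by (cases "i < N") (auto simp: U_def intro!: continuous_intros)
  qed
  define C where "C = sphere 0 1 \<inter> W (Suc n)"
  have "closed (W k)" for k
    by (simp add: W_sub closed_subspace)
  then have C: "compact C"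
    unfolding C_def by (intro compact_Int_closed) auto
  have contF: "continuous_on C (T \<circ> f \<circ> U)"
  proof (intro continuous_on_compose cT cU)
    show "continuous_on (U ` C) f"
      by (rule continuous_on_subset[OF cont]) (use U_sphere nN in \<open>auto simp: C_def\<close>)
  qed
  have FW: "(T \<circ> f \<circ> U) ` C \<subseteq> W (Suc n)"
    using T_sphere[of _ n] im U_sphere[of _ n] nN by (auto simp: C_def)
  obtain g0 where g0: "polynomial_function g0" "g0 ` C \<subseteq> W (Suc n)"
    "\<And>y. y \<in> C \<Longrightarrow> norm ((T \<circ> f \<circ> U) y - g0 y) < 1"
    using Stone_Weierstrass_polynomial_function_subspace[OF C contF zero_less_one W_sub FW] by metis
  \<comment> \<open>Passing to the odd part keeps the error below \<open>1\<close>, because \<open>f\<close> is odd.\<close>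
  define g1 where "g1 = (\<lambda>y. (1/2) *\<^sub>R (g0 y - g0 (- y)))"
  have C_minus: "- y \<in> C" if "y \<in> C" for y
    using that W_sub[of "Suc n"] by (auto simp: C_def subspace_neg)
  have "polynomial_function (\<lambda>y::'a. - y)"
    by (simp add: polynomial_function_minus polynomial_function_id)
  from polynomial_function_compose[OF this g0(1)] 
  have g1_poly: "polynomial_function g1"
    unfolding g1_def using g0(1) 
    by (intro polynomial_function_cmul polynomial_function_diff) (auto simp: o_def)
  have g1_W: "g1 y \<in> W (Suc n)" if "y \<in> C" for y
  proof -
    have "g0 y \<in> W (Suc n)" "g0 (-y) \<in> W (Suc n)"
      using g0(2) that C_minus by auto
    then show ?thesis
      unfolding g1_def using W_sub by (intro subspace_scale subspace_diff)
  qed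
  have g1_minus: "g1 (- y) = - g1 y" for y
    by (simp add: g1_def algebra_simps)
  have g1_near: "norm ((T \<circ> f \<circ> U) y - g1 y) < 1" if "y \<in> C" for y
  proof -
    have F: "(T \<circ> f \<circ> U) (- y) = - (T \<circ> f \<circ> U) y"
      using odd[OF U_sphere[of y n]] that nN by (simp add: U_minus T_minus C_def)
    have avg: "q - (1/2) *\<^sub>R (u - v) = (1/2) *\<^sub>R ((q - u) - (- q - v))" for q u v :: 'a
    proof -
      have "(q - u) - (- q - v) = (q + q) - (u - v)" by simp
      then show ?thesis by (simp only: scaleR_right_diff_distrib scaleR_half_double)
    qed
    have "norm ((T \<circ> f \<circ> U) y - g1 y) =
      (1/2) * norm (((T \<circ> f \<circ> U) y - g0 y) - ((T \<circ> f \<circ> U) (- y) - g0 (- y)))"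
      unfolding g1_def F avg by simp
    also have "\<dots> \<le> (1/2) * (norm ((T \<circ> f \<circ> U) y - g0 y) + norm ((T \<circ> f \<circ> U) (- y) - g0 (- y)))"
      by (intro mult_left_mono norm_triangle_ineq4) simp
    also have "\<dots> < 1"
      using g0(3)[OF that] g0(3)[OF C_minus[OF that]] by simp
    finally show ?thesis .
  qed
  have F_norm: "norm ((T \<circ> f \<circ> U) y) = 1" if "y \<in> C" for y
    using T_sphere[OF im[OF U_sphere[of y n]]] that nN by (auto simp: C_def)
  have g1_nz: "g1 y \<noteq> 0" if "y \<in> C" for y
    using g1_near[OF that] F_norm[OF that] by auto
  define g2 where "g2 = (\<lambda>y. g1 y /\<^sub>R norm (g1 y))"
  have sub: "sphere 0 1 \<inter> W n \<subseteq> C"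
    using W_mono[of n "Suc n"] by (auto simp: C_def)
  have g1_diff: "g1 differentiable_on sphere 0 1 \<inter> W n"
    using g1_poly by (rule differentiable_on_polynomial_function)
  have "g2 differentiable_on sphere 0 1 \<inter> W n"
    unfolding g2_def
    unfolding differentiable_on_def
  proof
    fix x assume x: "x \<in> sphere 0 1 \<inter> W n"
    have diff: "g1 differentiable (at x within sphere 0 1 \<inter> W n)"
      using g1_diff x by (simp add: differentiable_on_def)
    have nz: "g1 x \<noteq> 0"
      using g1_nz sub x by blast
    then have "norm differentiable (at (g1 x))"
      by (rule differentiable_norm_at)
    then have "(\<lambda>x. norm (g1 x)) differentiable (at x within sphere 0 1 \<inter> W n)"
      using diff by (rule differentiable_compose)
    then have "(\<lambda>x. inverse (norm (g1 x))) differentiable (at x within sphere 0 1 \<inter> W n)"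
      using nz by (intro differentiable_inverse) auto
    then show "(\<lambda>y. g1 y /\<^sub>R norm (g1 y)) differentiable (at x within sphere 0 1 \<inter> W n)"
      using diff by (rule differentiable_scaleR)
  qed
  then have "g2 ` (sphere 0 1 \<inter> W n) \<noteq> sphere 0 1 \<inter> W (Suc n)"
    by (intro spheremap_lemma1 W_sub) (use W_dim[of n] W_dim[of "Suc n"] nN W_mono in auto)
  moreover have "g2 y \<in> C" if "y \<in> C" for y
    using g1_nz[OF that] g1_W[OF that] W_sub by (auto simp: g2_def C_def intro: subspace_scale)
  then have "g2 ` (sphere 0 1 \<inter> W n) \<subseteq> C"
    using sub by blast
  ultimately obtain a' where a': "a' \<in> C" "a' \<notin> g2 ` (sphere 0 1 \<inter> W n)"
    unfolding C_def by blast
  define g where "g = U \<circ> g1 \<circ> T"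
  show thesis
  proof
    show "continuous_on (topspace (nsphere n)) g"
      unfolding g_def using g1_poly
      by (intro continuous_on_compose cT cU continuous_on_polymonial_function)
    have TC: "T x \<in> C" if "x \<in> topspace (nsphere n)" for x
      using T_sphere[OF that nN] by (simp add: C_def)
    show "g x i = 0" if "x \<in> topspace (nsphere n)" "i > n" for x i
      using U_W[OF g1_W[OF TC]] that by (simp add: g_def)
    show "g (\<lambda>i. - x i) = (\<lambda>i. - g x i)" if "x \<in> topspace (nsphere n)" for x
      by (simp add: g_def T_minus g1_minus U_minus)
    show "(\<Sum>i\<le>n. (f x i - g x i)\<^sup>2) < 1" if x: "x \<in> topspace (nsphere n)" for x
    proof -
      have fx: "f x \<in> topspace (nsphere n)" using im x by blast
      have "(\<Sum>i\<le>n. (f x i - g x i)\<^sup>2) = (norm (T (\<lambda>i. f x i - g x i)))\<^sup>2"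
        unfolding T_norm
        by (rule sum_trunc[symmetric]) (use nN fx U_W[OF g1_W[OF TC[OF x]]] in \<open>auto simp: topspace_nsphere g_def\<close>)
      also have "T (\<lambda>i. f x i - g x i) = (T \<circ> f \<circ> U) (T x) - g1 (T x)"
        unfolding T_diff using x nN by (simp add: g_def TU UT[of n] topspace_nsphere)
      also have "(norm \<dots>)\<^sup>2 < 1"
        using g1_near[OF TC[OF x]] by (simp add: abs_square_less_1)
      finally show ?thesis .
    qed
    show "U a' \<in> topspace (nsphere n)"
      using a' U_sphere nN by (simp add: C_def)
    show "g x \<noteq> (\<lambda>i. c * U a' i)" if x: "x \<in> topspace (nsphere m)" for x c
    proof
      assume eq: "g x = (\<lambda>i. c * U a' i)"
      have Tx: "T x \<in> sphere 0 1 \<inter> W n"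
        using T_sphere[OF x] nN by (simp add: n_def)
      have "T (g x) = c *\<^sub>R T (U a')"
        unfolding eq by (simp add: T_def scaleR_sum_right)
      then have g1c: "g1 (T x) = c *\<^sub>R a'"
        by (simp add: g_def TU)
      have "norm a' = 1"
        using a' by (simp add: C_def)
      then have norm_g1: "norm (g1 (T x)) = \<bar>c\<bar>"
        by (simp add: g1c)
      have "T x \<in> C" using sub Tx by blast
      then have "c \<noteq> 0"
        using g1_nz[of "T x"] g1c by auto
      then consider "c > 0" | "c < 0" by linarith
      then have "a' = g2 (T x) \<or> a' = g2 (- T x)"
      proof cases
        case 1
        then have "a' = g2 (T x)" by (simp add: g2_def norm_g1) (simp add: g1c)
        then show ?thesis ..
      next
        case 2
        then have "a' = g2 (- T x)" by (simp add: g2_def g1_minus norm_g1) (simp add: g1c)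
        then show ?thesis ..
      qed
      moreover have "- T x \<in> sphere 0 1 \<inter> W n"
        using Tx W_sub[of n] by (auto simp: subspace_neg)
      ultimately show False using a'(2) Tx by blast
    qed
  qed
qed


lemma odd_map_nsphere_0:
  assumes im: "\<And>x. x \<in> topspace (nsphere 0) \<Longrightarrow> f x \<in> topspace (nsphere 0)"
    and odd: "\<And>x. x \<in> topspace (nsphere 0) \<Longrightarrow> f (\<lambda>i. - x i) = (\<lambda>i. - f x i)"
    and x: "x \<in> topspace (nsphere 0)"
  shows "f (f x) = x"
proof -
  have two: "z = y \<or> z = (\<lambda>i. - y i)" if "z \<in> topspace (nsphere 0)" "y \<in> topspace (nsphere 0)" for z y
  proof -
    have z0: "z 0 = 1 \<or> z 0 = -1" and y0: "y 0 = 1 \<or> y 0 = -1"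
      using that by (auto simp: topspace_nsphere power2_eq_1_iff)
    have zero: "z i = 0" "y i = 0" if "i \<noteq> 0" for i
      using that \<open>z \<in> _\<close> \<open>y \<in> _\<close> by (auto simp: topspace_nsphere)
    from z0 y0 consider "z 0 = y 0" | "z 0 = - y 0" by fastforce
    then show ?thesis
    proof cases
      case 1
      have "z i = y i" for i using 1 zero[of i] by (cases "i = 0") auto
      then show ?thesis by blast
    next
      case 2
      have "z i = - y i" for i using 2 zero[of i] by (cases "i = 0") auto
      then show ?thesis by blast
    qed
  qed
  from two[OF im[OF x] x] odd[OF x] show ?thesis by auto
qed

text \<open>
  Borsuk's theorem, by induction on the dimension. If \<open>f\<close> maps the equator into itself, then its
  degree has the parity of the degree of the restriction
  (\<open>Borsuk_odd_mapping_degree_step\<close>). A general \<open>f\<close> is brought into this situation by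
  changes that keep it odd and cannot turn an even degree into an odd one: replace it by the approximation \<open>g\<close>
  above, move the missing direction \<open>a\<close> to the pole by an invertible linear map \<open>R\<close>, and then shrink the
  last coordinate, to \<open>0\<close> on the equator.
\<close>
lemma odd_Brouwer_degree2_odd_map:
  fixes f :: "(nat \<Rightarrow> real) \<Rightarrow> nat \<Rightarrow> real"
  assumes n: "n < DIM('a::euclidean_space)"
    and cont: "continuous_on (topspace (nsphere n)) f"
    and im: "\<And>x. x \<in> topspace (nsphere n) \<Longrightarrow> f x \<in> topspace (nsphere n)"
    and odd: "\<And>x. x \<in> topspace (nsphere n) \<Longrightarrow> f (\<lambda>i. - x i) = (\<lambda>i. - f x i)"
  shows "odd (Brouwer_degree2 n f)"
  using assms
proof (induction n arbitrary: f)
  case 0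
  have cm: "continuous_map (nsphere 0) (nsphere 0) f"
    using 0 by (auto simp: continuous_map_nsphere_iff)
  have "Brouwer_degree2 0 (f \<circ> f) = Brouwer_degree2 0 id"
    by (rule Brouwer_degree2_eq) (use odd_map_nsphere_0[of f] 0 in auto)
  then have "Brouwer_degree2 0 f * Brouwer_degree2 0 f = 1"
    using Brouwer_degree2_compose[OF cm cm] by simp
  then show ?case
    by (metis even_mult_iff odd_one)
next
  case (Suc m)
  define n where "n = Suc m"
  let ?S = "topspace (nsphere n)"
  note f = Suc.prems(2-4)[folded n_def]
  have sub: "topspace (nsphere m) \<subseteq> ?S"
    by (auto simp: topspace_nsphere n_def)
  obtain g a where g: "continuous_on ?S g" "\<And>x i. x \<in> ?S \<Longrightarrow> i > n \<Longrightarrow> g x i = 0"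
    "\<And>x. x \<in> ?S \<Longrightarrow> g (\<lambda>i. - x i) = (\<lambda>i. - g x i)"
    and near: "\<And>x. x \<in> ?S \<Longrightarrow> (\<Sum>i\<le>n. (f x i - g x i)\<^sup>2) < 1"
    and a: "a \<in> ?S" and avoid: "\<And>x c. x \<in> topspace (nsphere m) \<Longrightarrow> g x \<noteq> (\<lambda>i. c * a i)"
    using odd_map_approximation[OF Suc.prems(1) n_def f] by blast
  obtain l where l: "a l \<noteq> 0" "l \<le> n"
    using nsphere_subset_punctured[of n] a sum_squares_punctured[of a n] unfolding punctured_space_def
    by (smt (verit) DiffD1 mem_Collect_eq not_less_eq_eq subsetD topspace_nsphere zero_power2 sum.neutral atMost_iff)
  \<comment> \<open>\<open>R\<close> is linear and sends \<open>a\<close> to a multiple of the \<open>n\<close>-th unit vector: eliminate all other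
    coordinates using the pivot \<open>a l\<close>, then exchange coordinates \<open>l\<close> and \<open>n\<close>. Only the line spanned by \<open>a\<close> loses all its first \<open>n\<close> coordinates.\<close>
  define R where "R = (\<lambda>x i. if i = n then x l else if i = l then x n - a n / a l * x l
     else x i - a i / a l * x l :: real)"
  have R_kernel: "x i = x l / a l * a i" if "\<And>i. i < n \<Longrightarrow> R x i = 0" "i \<le> n" for x i
  proof (cases "i = l")
    case True then show ?thesis using l by simp
  next
    case False
    show ?thesis
    proof (cases "i = n")
      case True
      then show ?thesis using that(1)[of l] False l by (auto simp: R_def)
    next
      case False
      then show ?thesis using that(1)[of i] \<open>i \<noteq> l\<close> that(2) l by (auto simp: R_def)
    qed
  qed
  have R_minus: "R (\<lambda>i. - x i) = (\<lambda>i. - R x i)" for x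
    by (auto simp: R_def fun_eq_iff)
  have R_cont: "continuous_on X (\<lambda>x. R (q x))" if "continuous_on X q"
    for X :: "'b::topological_space set" and q
  proof (rule continuous_on_coordinatewise_then_product)
    note c = continuous_on_product_then_coordinatewise[OF that]
    show "continuous_on X (\<lambda>x. R (q x) i)" for i
      unfolding R_def by (cases "i = n"; cases "i = l") (use l in \<open>auto intro!: continuous_intros c\<close>)
  qed
  have R_punctured: "R x \<in> punctured_space (Suc n)" if "x \<in> punctured_space (Suc n)" for x
  proof -
    have zero: "x i = 0" "a i = 0" if "i > n" for i
      using \<open>x \<in> _\<close> a that by (auto simp: punctured_space_def topspace_nsphere)
    have "x = (\<lambda>_. 0)" if "R x = (\<lambda>_. 0)"
    proof
      fix i
      have "x l = 0" using that l by (auto simp: R_def fun_eq_iff dest!: spec[of _ n])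
      then show "x i = 0"
        using R_kernel[of x i] that zero(1)[of i] by (cases "i \<le> n") auto
    qed
    then show ?thesis
      using that l zero by (auto simp: punctured_space_def R_def)
  qed
  have line: "(\<lambda>i. (1 - t) * f x i + t * g x i) \<in> punctured_space (Suc n)"
    if x: "x \<in> ?S" and t: "t \<in> {0..1}" for x t
  proof -
    have fx: "(\<Sum>i\<le>n. (f x i)\<^sup>2) = 1" "\<And>i. i > n \<Longrightarrow> f x i = 0"
      using f(2)[OF x] by (auto simp: topspace_nsphere)
    have False if "\<And>i. (1 - t) * f x i + t * g x i = 0"
    proof -
      have "f x i = t * (f x i - g x i)" for i
        using that[of i] by (simp add: algebra_simps)
      then have "1 = (\<Sum>i\<le>n. (t * (f x i - g x i))\<^sup>2)"
        using fx(1) by (metis (no_types, lifting) sum.cong)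
      also have "\<dots> = t\<^sup>2 * (\<Sum>i\<le>n. (f x i - g x i)\<^sup>2)"
        by (simp add: power_mult_distrib sum_distrib_left)
      also have "\<dots> \<le> 1 * (\<Sum>i\<le>n. (f x i - g x i)\<^sup>2)"
        using t by (intro mult_right_mono sum_nonneg) (auto simp: power_le_one)
      also have "\<dots> < 1" using near[OF x] by simp
      finally show False by simp
    qed
    then show ?thesis
      using fx(2) g(2)[OF x] by (auto simp: punctured_space_def fun_eq_iff Suc_le_eq)
  qed
  have cont_fst: "continuous_on X (\<lambda>z::real \<times> (nat \<Rightarrow> real). fst z)"
    and cont_snd: "continuous_on X (\<lambda>z::real \<times> (nat \<Rightarrow> real). snd z i)" for X i
    by (rule continuous_on_fst[OF continuous_on_id],
        rule continuous_on_product_then_coordinatewise[OF continuous_on_snd[OF continuous_on_id]])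
  have cont_comp: "continuous_on ({0..1::real} \<times> ?S) (\<lambda>z. q (snd z) i)"
    if "continuous_on ?S q" for q :: "_ \<Rightarrow> nat \<Rightarrow> real" and i
  proof -
    have "continuous_on ({0..1::real} \<times> ?S) (\<lambda>z. q (snd z))"
      by (rule continuous_on_compose2[OF that continuous_on_snd[OF continuous_on_id]]) simp
    then show ?thesis by (rule continuous_on_product_then_coordinatewise)
  qed
  have deg_fg: "Brouwer_degree2 n f = Brouwer_degree2 n (\<lambda>x. nsphere_proj n (g x))"
  proof -
    define F where "F = (\<lambda>z i. (1 - fst z) * f (snd z) i + fst z * g (snd z) i)"
    have "continuous_on ({0..1} \<times> ?S) F"
      unfolding F_def
      by (intro continuous_on_coordinatewise_then_product continuous_intros cont_comp f(1) g(1) cont_fst)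
    moreover have "F ` ({0..1} \<times> ?S) \<subseteq> punctured_space (Suc n)"
      using line by (auto simp: F_def)
    ultimately have "Brouwer_degree2 n (\<lambda>x. nsphere_proj n (F (0, x))) = Brouwer_degree2 n (\<lambda>x. nsphere_proj n (F (1, x)))"
      by (rule Brouwer_degree2_proj_homotopy)
    moreover have "Brouwer_degree2 n (\<lambda>x. nsphere_proj n (F (0, x))) = Brouwer_degree2 n f"
      by (rule Brouwer_degree2_eq) (use f(2) in \<open>simp add: F_def nsphere_proj_nsphere\<close>)
    ultimately show ?thesis by (simp add: F_def)
  qed
  have g_punct: "g x \<in> punctured_space (Suc n)" if "x \<in> ?S" for x
    using line[OF that, of 1] by simp
  define k where "k = (\<lambda>x. R (nsphere_proj n (g x)))"
  have pg_cont: "continuous_on ?S (\<lambda>x. nsphere_proj n (g x))"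
    using continuous_on_nsphere_proj[OF g(1)] g_punct by blast
  have k_cont: "continuous_on ?S k"
    unfolding k_def by (rule R_cont[OF pg_cont])
  have k_punct: "k x \<in> punctured_space (Suc n)" if "x \<in> ?S" for x
    unfolding k_def
    using R_punctured nsphere_subset_punctured nsphere_proj_in_nsphere[OF g_punct[OF that]] by blast
  have k_minus: "k (\<lambda>i. - x i) = (\<lambda>i. - k x i)" if "x \<in> ?S" for x
    by (simp add: k_def g(3)[OF that] nsphere_proj_minus R_minus)
  \<comment> \<open>On the equator the first \<open>n\<close> coordinates of \<open>k\<close> do not all vanish, because \<open>g\<close> misses the line
    spanned by \<open>a\<close>.\<close>
  have k_equator: "\<exists>i<n. k x i \<noteq> 0" if x: "x \<in> topspace (nsphere m)" for x
  proof (rule ccontr)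
    assume "\<not> (\<exists>i<n. k x i \<noteq> 0)"
    then have R0: "R (nsphere_proj n (g x)) i = 0" if "i < n" for i
      using that by (simp add: k_def)
    have xS: "x \<in> ?S" using x sub by blast
    define s where "s = sqrt (\<Sum>j\<le>n. (g x j)\<^sup>2)"
    have s: "s > 0" using sum_squares_punctured[OF g_punct[OF xS]] by (simp add: s_def)
    let ?y = "nsphere_proj n (g x)"
    have "g x i = s * ?y l / a l * a i" for i
    proof (cases "i \<le> n")
      case True
      have "g x i = s * ?y i" using s by (simp add: nsphere_proj_def s_def)
      then show ?thesis using R_kernel[OF R0 True] by simp
    next
      case False
      then show ?thesis using a g(2)[OF xS, of i] by (simp add: topspace_nsphere)
    qed
    then show False
      using avoid[OF x, of "s * ?y l / a l"] by blast
  qed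
  \<comment> \<open>The factor of the last coordinate stays positive off the equator, so a zero of \<open>K\<close> could only
    occur on the equator; at time \<open>1\<close> the factor is \<open>\<bar>x n\<bar>\<close>, which vanishes there.\<close>
  define K where "K = (\<lambda>z i. if i = n then ((1 - fst z) + fst z * \<bar>snd z n\<bar>) * k (snd z) i else k (snd z) i)"
  have K_cont: "continuous_on ({0..1} \<times> ?S) K"
  proof (rule continuous_on_coordinatewise_then_product)
    show "continuous_on ({0..1} \<times> ?S) (\<lambda>z. K z i)" for i
      unfolding K_def if_distrib
      by (cases "i = n")
         (simp_all add: cont_comp[OF k_cont] cont_fst cont_snd continuous_on_mult continuous_on_add
           continuous_on_diff continuous_on_rabs)
  qed
  have K_punct: "K ` ({0..1} \<times> ?S) \<subseteq> punctured_space (Suc n)"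
  proof clarify
    fix t :: real and x assume t: "t \<in> {0..1}" and x: "x \<in> ?S"
    have kz: "k x i = 0" if "i > n" for i
      using k_punct[OF x] that by (auto simp: punctured_space_def)
    have nz: "\<exists>i. K (t, x) i \<noteq> 0"
    proof (cases "x n = 0")
      case True
      then have "x \<in> topspace (nsphere m)"
        using topspace_nsphere_minus1[OF x] by (simp add: n_def)
      from k_equator[OF this] show ?thesis by (auto simp: K_def)
    next
      case False
      obtain i where i: "k x i \<noteq> 0"
        using k_punct[OF x] by (auto simp: punctured_space_def)
      have "0 < (1 - t) + t * \<bar>x n\<bar>"
        using False t by (cases "t = 1") (auto intro: add_pos_nonneg)
      with i show ?thesis by (auto simp: K_def intro!: exI[of _ i])
    qed
    have "\<forall>i\<ge>Suc n. K (t, x) i = 0"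
      using kz by (simp add: K_def)
    with nz show "K (t, x) \<in> punctured_space (Suc n)"
      unfolding punctured_space_def by force
  qed
  define h where "h = (\<lambda>x. nsphere_proj n (K (1, x)))"
  have "Brouwer_degree2 n (\<lambda>x. nsphere_proj n (K (0, x))) = Brouwer_degree2 n h"
    unfolding h_def by (rule Brouwer_degree2_proj_homotopy[OF K_cont K_punct])
  moreover have "(\<lambda>x. nsphere_proj n (K (0, x))) = (\<lambda>x. nsphere_proj n (R x)) \<circ> (\<lambda>x. nsphere_proj n (g x))"
    by (auto simp: K_def k_def fun_eq_iff intro!: arg_cong2[where f = "nsphere_proj n"])
  moreover have "continuous_map (nsphere n) (nsphere n) (\<lambda>x. nsphere_proj n (R x))"
    unfolding continuous_map_nsphere_iff
  proof
    have RS: "R x \<in> punctured_space (Suc n)" if "x \<in> ?S" for x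
      using R_punctured nsphere_subset_punctured that by blast
    show "continuous_on ?S (\<lambda>x. nsphere_proj n (R x))"
      by (rule continuous_on_nsphere_proj[OF R_cont[OF continuous_on_id]]) (use RS in auto)
    show "(\<lambda>x. nsphere_proj n (R x)) \<in> ?S \<rightarrow> ?S"
      using RS nsphere_proj_in_nsphere by auto
  qed
  moreover have "continuous_map (nsphere n) (nsphere n) (\<lambda>x. nsphere_proj n (g x))"
    unfolding continuous_map_nsphere_iff using pg_cont g_punct nsphere_proj_in_nsphere by blast
  \<comment> \<open>Whatever the degree of the map induced by \<open>R\<close>, oddness of the product will give oddness of
    the other factor.\<close>
  ultimately have deg_h: "Brouwer_degree2 n h = Brouwer_degree2 n (\<lambda>x. nsphere_proj n (R x)) * Brouwer_degree2 n f"
    by (simp only: deg_fg Brouwer_degree2_compose)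
  have h_cont: "continuous_on ?S h"
    unfolding h_def
  proof (rule continuous_on_nsphere_proj)
    show "continuous_on ?S (\<lambda>x. K (1, x))"
      by (rule continuous_on_compose2[OF K_cont]) (auto intro!: continuous_intros)
    show "(\<lambda>x. K (1, x)) ` ?S \<subseteq> punctured_space (Suc n)"
      using K_punct by auto
  qed
  have h_im: "h x \<in> ?S" if "x \<in> ?S" for x
    unfolding h_def by (rule nsphere_proj_in_nsphere) (use K_punct that in auto)
  have h_odd: "h (\<lambda>i. - x i) = (\<lambda>i. - h x i)" if "x \<in> ?S" for x
  proof -
    have "K (1, \<lambda>i. - x i) = (\<lambda>i. - K (1, x) i)"
      by (auto simp: K_def k_minus[OF that] fun_eq_iff)
    then show ?thesis by (simp add: h_def nsphere_proj_minus)
  qed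
  have h_equator: "h x \<in> topspace (nsphere m)" if "x \<in> topspace (nsphere m)" for x
  proof -
    have "x n = 0" using that by (simp add: topspace_nsphere n_def)
    then have "h x n = 0" by (simp add: h_def nsphere_proj_def K_def)
    then show ?thesis
      using topspace_nsphere_minus1[OF h_im, of x] that sub by (auto simp: n_def)
  qed
  have "even (Brouwer_degree2 n h - Brouwer_degree2 (n - Suc 0) h)"
  proof (rule Borsuk_odd_mapping_degree_step)
    show "continuous_map (nsphere n) (nsphere n) h"
      unfolding continuous_map_nsphere_iff using h_cont h_im by blast
    show "(h \<circ> (\<lambda>x i. - x i)) u = ((\<lambda>x i. - x i) \<circ> h) u" if "u \<in> ?S" for u
      using h_odd[OF that] by simp
    show "h \<in> topspace (nsphere (n - Suc 0)) \<rightarrow> topspace (nsphere (n - Suc 0))"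
      using h_equator by (simp add: n_def)
  qed
  moreover have "odd (Brouwer_degree2 m h)"
  proof (rule Suc.IH)
    show "m < DIM('a)" using Suc.prems(1) by simp
    show "continuous_on (topspace (nsphere m)) h"
      using h_cont sub continuous_on_subset by blast
  qed (use h_equator h_odd sub in blast)+
  ultimately have "odd (Brouwer_degree2 n h)"
    by (simp add: n_def)
  then have "odd (Brouwer_degree2 n f)"
    by (simp add: deg_h)
  then show ?case
    by (simp add: n_def)
qed

text \<open>
  If \<open>h \<le> n\<close>, the normalized map is an odd self-map of the \<open>n\<close>-sphere that misses the pole. Its degree
  would be both odd and \<open>0\<close>.
\<close>
theorem Borsuk_Ulam_odd_map:
  fixes \<phi> :: "(nat \<Rightarrow> real) \<Rightarrow> nat \<Rightarrow> real"
  assumes n: "n < DIM('a::euclidean_space)"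
    and cont: "continuous_on (topspace (nsphere n)) \<phi>"
    and im: "\<And>x. x \<in> topspace (nsphere n) \<Longrightarrow> \<phi> x \<in> punctured_space h"
    and odd: "\<And>x. x \<in> topspace (nsphere n) \<Longrightarrow> \<phi> (\<lambda>i. - x i) = (\<lambda>i. - \<phi> x i)"
  shows "n < h"
proof (rule ccontr)
  assume "\<not> n < h"
  then have "h \<le> n" by simp
  then have punct: "\<phi> x \<in> punctured_space (Suc n)" if "x \<in> topspace (nsphere n)" for x
    using im[OF that] by (auto simp: punctured_space_def)
  define f where "f = (\<lambda>x. nsphere_proj n (\<phi> x))"
  have f_cont: "continuous_on (topspace (nsphere n)) f"
    unfolding f_def by (rule continuous_on_nsphere_proj[OF cont]) (use punct in auto)
  have f_im: "f x \<in> topspace (nsphere n)" if "x \<in> topspace (nsphere n)" for x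
    unfolding f_def by (rule nsphere_proj_in_nsphere[OF punct[OF that]])
  have "odd (Brouwer_degree2 n f)"
    using n f_cont f_im
  proof (rule odd_Brouwer_degree2_odd_map[where 'a = 'a])
    show "f (\<lambda>i. - x i) = (\<lambda>i. - f x i)" if "x \<in> topspace (nsphere n)" for x
      by (simp only: f_def odd[OF that] nsphere_proj_minus)
  qed
  moreover have "Brouwer_degree2 n f = 0"
  proof (rule Brouwer_degree2_nonsurjective)
    show "continuous_map (nsphere n) (nsphere n) f"
      unfolding continuous_map_nsphere_iff using f_cont f_im by blast
    define e :: "nat \<Rightarrow> real" where "e = (\<lambda>i. if i = n then 1 else 0)"
    have "e \<in> topspace (nsphere n)"
      by (simp add: topspace_nsphere e_def power2_eq_square if_distrib[where f = "\<lambda>x. x * _"] cong: if_cong)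
    moreover have fe: "f x \<noteq> e" if "x \<in> topspace (nsphere n)" for x
    proof -
      have "f x n = 0"
        using im[OF that] \<open>h \<le> n\<close> by (simp add: f_def nsphere_proj_def punctured_space_def)
      moreover have "e n = 1" by (simp add: e_def)
      ultimately show ?thesis by auto
    qed
    moreover have "e \<notin> f ` topspace (nsphere n)"
      using fe by auto
    ultimately show "f ` topspace (nsphere n) \<noteq> topspace (nsphere n)"
      by metis
  qed
  ultimately show False by simp
qed

section \<open>Path distance and tent functions\<close>

text \<open>
  A walk with its length as an argument: the induction rule replaces manipulations of
  vertex sequences.
\<close>
inductive walk :: "('v \<times> 'v) set \<Rightarrow> ('v \<Rightarrow> 'v \<Rightarrow> real) \<Rightarrow> 'v \<Rightarrow> real \<Rightarrow> 'v \<Rightarrow> bool"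
  for E w u where
  walk_refl: "walk E w u 0 u"
| walk_step: "walk E w u l v \<Longrightarrow> (v, z) \<in> E \<Longrightarrow> walk E w u (l + inverse (w v z)) z"

lemma walk_iff_sequence:
  "walk E w u l v \<longleftrightarrow> (\<exists>(n::nat) x. l = (\<Sum>i=1..n. inverse (w (x (i - 1)) (x i))) \<and>
     x 0 = u \<and> x n = v \<and> (\<forall>i\<in>{1..n}. (x (i - 1), x i) \<in> E))"
proof
  assume "walk E w u l v"
  then show "\<exists>(n::nat) x. l = (\<Sum>i=1..n. inverse (w (x (i - 1)) (x i))) \<and>
     x 0 = u \<and> x n = v \<and> (\<forall>i\<in>{1..n}. (x (i - 1), x i) \<in> E)"
  proof induction
    case walk_refl
    show ?case by (intro exI[of _ 0] exI[of _ "\<lambda>_. u"]) simp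
  next
    case (walk_step l v z)
    then obtain n :: nat and x where x: "l = (\<Sum>i=1..n. inverse (w (x (i - 1)) (x i)))"
      "x 0 = u" "x n = v" "\<forall>i\<in>{1..n}. (x (i - 1), x i) \<in> E" by blast
    let ?y = "x(Suc n := z)"
    have "(\<Sum>i=1..n. inverse (w (?y (i - 1)) (?y i))) = l"
      unfolding x(1) by (rule sum.cong) auto
    then show ?case
      using x walk_step.hyps by (intro exI[of _ "Suc n"] exI[of _ ?y]) (auto simp: le_Suc_eq)
  qed
next
  assume "\<exists>(n::nat) x. l = (\<Sum>i=1..n. inverse (w (x (i - 1)) (x i))) \<and>
     x 0 = u \<and> x n = v \<and> (\<forall>i\<in>{1..n}. (x (i - 1), x i) \<in> E)"
  then obtain n :: nat and x where x: "l = (\<Sum>i=1..n. inverse (w (x (i - 1)) (x i)))"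
      "x 0 = u" "x n = v" "\<forall>i\<in>{1..n}. (x (i - 1), x i) \<in> E" by blast
  from x(4) have "walk E w (x 0) (\<Sum>i=1..n. inverse (w (x (i - 1)) (x i))) (x n)"
  proof (induction n)
    case 0
    show ?case by (simp add: walk.walk_refl)
  next
    case (Suc n)
    then have "walk E w (x 0) (\<Sum>i=1..n. inverse (w (x (i - 1)) (x i))) (x n)" by simp
    moreover have "(x n, x (Suc n)) \<in> E" using bspec[OF Suc.prems, of "Suc n"] by simp
    ultimately show ?case
      using walk.walk_step[of E w "x 0" _ "x n" "x (Suc n)"] by simp
  qed
  with x show "walk E w u l v" by simp
qed

lemma graph_dist_eq_Inf_walk: "graph_dist E w u v = Inf {ereal l | l. walk E w u l v}"
  unfolding graph_dist_def walk_iff_sequence by (rule arg_cong[where f = Inf]) blast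

lemma le_graph_dist_iff: "L \<le> graph_dist E w u v \<longleftrightarrow> (\<forall>l. walk E w u l v \<longrightarrow> L \<le> ereal l)"
  unfolding graph_dist_eq_Inf_walk le_Inf_iff by blast

lemma graph_dist_le: "walk E w u l v \<Longrightarrow> graph_dist E w u v \<le> ereal l"
  using le_graph_dist_iff[of "graph_dist E w u v" E w u v] by simp

lemma walk_trans: "walk E w v l' z \<Longrightarrow> walk E w u l v \<Longrightarrow> walk E w u (l + l') z"
proof (induction rule: walk.induct)
  case (walk_step l' v' z)
  then show ?case using walk.walk_step[of E w u "l + l'" v' z] by (simp add: add.assoc)
qed simp

text \<open>
  The maximum is taken in the extended reals, so that a node at infinite distance from \<open>a\<close> gets the
  value \<open>0\<close>.
\<close>
definition tent :: "('v \<times> 'v) set \<Rightarrow> ('v \<Rightarrow> 'v \<Rightarrow> real) \<Rightarrow> real \<Rightarrow> 'v \<Rightarrow> 'v \<Rightarrow> real" where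
  "tent E w r a u = real_of_ereal (max 0 (ereal r - graph_dist E w a u))"

context connected_weighted_graph
begin

lemma walk_nonneg: "walk E w u l v \<Longrightarrow> l \<ge> 0"
proof (induction rule: walk.induct)
  case (walk_step l v z)
  then show ?case using w_pos[of v z] by simp
qed simp

lemma walk_edge: "(u, v) \<in> E \<Longrightarrow> walk E w u (inverse (w u v)) v"
  using walk.walk_step[OF walk.walk_refl] by fastforce

lemma walk_sym: "walk E w u l v \<Longrightarrow> walk E w v l u"
proof (induction rule: walk.induct)
  case (walk_step l v z)
  have "(z, v) \<in> E" using walk_step.hyps sym_E by (auto simp: sym_def)
  then have "walk E w z (inverse (w v z)) v"
    using walk_edge w_sym walk_step.hyps by metis
  from walk_trans[OF walk_step.IH this] show ?case by (simp add: add.commute)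
qed (rule walk.walk_refl)

lemma graph_dist_nonneg: "0 \<le> graph_dist E w u v"
  unfolding le_graph_dist_iff using walk_nonneg by auto

lemma graph_dist_self: "graph_dist E w u u = 0"
  using graph_dist_le[OF walk.walk_refl, of E w u] graph_dist_nonneg[of u u]
  by (simp add: zero_ereal_def)

lemma graph_dist_sym: "graph_dist E w u v = graph_dist E w v u"
  by (rule antisym) (auto simp: le_graph_dist_iff intro: graph_dist_le walk_sym)

text \<open>
  The argument avoids minimizing walks: one of the two distances is fixed and subtracted while the
  other is compared with every walk, which needs care only when a distance is infinite.
\<close>
lemma graph_dist_triangle: "graph_dist E w u z \<le> graph_dist E w u v + graph_dist E w v z"
proof -
  have 1: "graph_dist E w u z \<le> ereal l + graph_dist E w v z" if "walk E w u l v" for l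
  proof -
    have "graph_dist E w u z - ereal l \<le> graph_dist E w v z"
      unfolding le_graph_dist_iff
    proof clarify
      fix l' assume "walk E w v l' z"
      then have "graph_dist E w u z \<le> ereal (l + l')"
        using walk_trans that by (intro graph_dist_le)
      then show "graph_dist E w u z - ereal l \<le> ereal l'"
        by (cases "graph_dist E w u z") auto
    qed
    then show ?thesis
      by (cases "graph_dist E w u z"; cases "graph_dist E w v z") auto
  qed
  show ?thesis
  proof (cases "graph_dist E w v z")
    case (real d)
    have "graph_dist E w u z - ereal d \<le> graph_dist E w u v"
      unfolding le_graph_dist_iff
    proof clarify
      fix l assume "walk E w u l v"
      from 1[OF this] show "graph_dist E w u z - ereal d \<le> ereal l"
        using real by (cases "graph_dist E w u z") auto
    qed
    then show ?thesis
      using real by (cases "graph_dist E w u z"; cases "graph_dist E w u v") auto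
  qed (use graph_dist_nonneg[of v z] in auto)
qed

text \<open>A walk between distinct nodes contains an edge, and there are finitely many edges.\<close>
lemma graph_dist_bounded_below: "\<exists>\<delta>>0. \<forall>u v. u \<noteq> v \<longrightarrow> ereal \<delta> \<le> graph_dist E w u v"
proof -
  define D where "D = insert 1 ((\<lambda>(x, y). inverse (w x y)) ` E)"
  have D: "finite D" "D \<noteq> {}" "\<forall>d\<in>D. d > 0"
    using w_pos by (auto simp: D_def)
  have *: "u = z \<or> Min D \<le> l" if "walk E w u l z" for u l z
    using that
  proof induction
    case (walk_step l v z)
    have "Min D \<le> inverse (w v z)"
      using walk_step.hyps(2) D by (intro Min_le) (auto simp: D_def)
    then show ?case using walk_nonneg[OF walk_step.hyps(1)] by auto
  qed simp
  have "ereal (Min D) \<le> graph_dist E w u v" if "u \<noteq> v" for u v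
    unfolding le_graph_dist_iff using * that by auto
  moreover have "Min D > 0" using D by simp
  ultimately show ?thesis by blast
qed

lemma tent_nonneg: "0 \<le> tent E w r a u"
  by (simp add: tent_def real_of_ereal_pos)

lemma tent_self: "r > 0 \<Longrightarrow> tent E w r a a = r"
  by (simp add: tent_def graph_dist_self max_def)

lemma tent_eq_0_iff: "tent E w r a u = 0 \<longleftrightarrow> ereal r \<le> graph_dist E w a u"
  using graph_dist_nonneg[of a u]
  by (cases "graph_dist E w a u") (auto simp: tent_def max_def)

lemma graph_dist_tent: "tent E w r a u > 0 \<Longrightarrow> graph_dist E w a u = ereal (r - tent E w r a u)"
  using graph_dist_nonneg[of a u]
  by (cases "graph_dist E w a u") (auto simp: tent_def max_def split: if_splits)

lemma tent_ge: "graph_dist E w a u \<le> ereal d \<Longrightarrow> r - d \<le> tent E w r a u"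
  using graph_dist_nonneg[of a u]
  by (cases "graph_dist E w a u") (auto simp: tent_def max_def split: if_splits)

lemma tent_edge:
  assumes "(u, v) \<in> E"
  shows "\<bar>tent E w r a u - tent E w r a v\<bar> \<le> inverse (w u v)"
proof -
  have *: "tent E w r a x \<le> tent E w r a y + inverse (w x y)" if e: "(x, y) \<in> E" for x y
  proof (cases "tent E w r a x > 0")
    case True
    have "graph_dist E w a y \<le> graph_dist E w a x + ereal (inverse (w x y))"
      using graph_dist_triangle[of a y x] graph_dist_le[OF walk_edge[OF e]]
      by (meson add_left_mono order_trans)
    then have "graph_dist E w a y \<le> ereal (r - tent E w r a x + inverse (w x y))"
      unfolding graph_dist_tent[OF True] by simp
    from tent_ge[OF this, of r] show ?thesis by (simp add: algebra_simps)
  next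
    case False
    then show ?thesis using tent_nonneg[of r a y] w_pos[OF e] by (smt (verit) positive_imp_inverse_positive)
  qed
  from *[OF assms] *[of v u] assms sym_E w_sym[OF assms] show ?thesis
    by (auto simp: sym_def abs_le_iff algebra_simps)
qed

text \<open>
  For an edge this bounds the sum of the heights of two different tents at its ends by its length;
  for the trivial walk it says that the supports are disjoint.
\<close>
lemma tents_separated:
  assumes sep: "ereal (2 * r) \<le> graph_dist E w a b"
    and walk: "walk E w u l v"
    and pos: "tent E w r a u > 0" "tent E w r b v > 0"
  shows "tent E w r a u + tent E w r b v \<le> l"
proof -
  have "graph_dist E w a b \<le> graph_dist E w a u + (graph_dist E w u v + graph_dist E w v b)"
    using graph_dist_triangle[of a b u] add_left_mono[OF graph_dist_triangle[of u b v]]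
    by (rule order_trans)
  also have "graph_dist E w v b = graph_dist E w b v"
    by (rule graph_dist_sym)
  also have "graph_dist E w a u + (graph_dist E w u v + graph_dist E w b v) \<le>
     graph_dist E w a u + (ereal l + graph_dist E w b v)"
    by (intro add_left_mono add_right_mono graph_dist_le walk)
  also have "\<dots> = ereal (2 * r - tent E w r a u - tent E w r b v + l)"
    unfolding graph_dist_tent[OF pos(1)] graph_dist_tent[OF pos(2)] by simp
  finally show ?thesis
    using sep order_trans[of "ereal (2 * r)"] by fastforce
qed

end

section \<open>Finite-dimensional \<open>p\<close>-norms and genus\<close>
lemma abs_le_p_norm:
  assumes "p > 0"
  shows "\<bar>f $ u\<bar> \<le> p_norm p f"
proof -
  have "\<bar>f $ u\<bar> = (\<bar>f $ u\<bar> powr p) powr (1 / p)"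
    using assms by (simp add: powr_powr)
  also have "\<dots> \<le> (\<Sum>u\<in>UNIV. \<bar>f $ u\<bar> powr p) powr (1 / p)"
    using assms by (intro powr_mono2 member_le_sum) auto
  finally show ?thesis by (simp add: p_norm_def)
qed

lemma p_norm_le:
  assumes "p > 0" "\<And>u. \<bar>f $ u\<bar> \<le> M"
  shows "p_norm p (f :: real ^ 'v::finite) \<le> real CARD('v) powr (1 / p) * M"
proof -
  have M: "M \<ge> 0" using assms(2) abs_ge_zero order_trans by blast
  have "(\<Sum>u\<in>UNIV. \<bar>f $ u\<bar> powr p) \<le> (\<Sum>u\<in>(UNIV::'v set). M powr p)"
    using assms by (intro sum_mono powr_mono2) auto
  then have "p_norm p f \<le> (real CARD('v) * M powr p) powr (1 / p)"
    unfolding p_norm_def using assms by (intro powr_mono2) (auto intro: sum_nonneg)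
  also have "\<dots> = real CARD('v) powr (1 / p) * M"
    using assms(1) M by (simp add: powr_mult powr_powr)
  finally show ?thesis .
qed

lemma grad_norm_powr:
  assumes "p > 0"
  shows "grad_norm E w p f powr p = 1 / 2 * (\<Sum>(u, v)\<in>E. \<bar>w u v * (f $ v - f $ u)\<bar> powr p)"
  using assms by (simp add: grad_norm_def powr_powr sum_nonneg case_prod_unfold)

lemma p_norm_powr: "p > 0 \<Longrightarrow> p_norm p f powr p = (\<Sum>u\<in>UNIV. \<bar>f $ u\<bar> powr p)"
  by (simp add: p_norm_def powr_powr sum_nonneg)

lemma p_norm_scale:
  assumes "p > 0"
  shows "p_norm p (c *\<^sub>R f) = \<bar>c\<bar> * p_norm p f"
  using assms by (simp add: p_norm_def abs_mult powr_mult powr_powr sum_nonneg flip: sum_distrib_left)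

lemma p_norm_pos: "p > 0 \<Longrightarrow> f \<noteq> 0 \<Longrightarrow> p_norm p f > 0"
proof -
  assume "p > 0" "f \<noteq> 0"
  then obtain i where "f $ i \<noteq> 0" by (auto simp: vec_eq_iff)
  then show ?thesis using abs_le_p_norm[OF \<open>p > 0\<close>, of f i] by simp
qed

lemma continuous_on_p_norm:
  assumes "p > 0" "continuous_on S f"
  shows "continuous_on S (\<lambda>x. p_norm p (f x))"
  unfolding p_norm_def using assms by (intro continuous_intros continuous_on_powr' ballI conjI) (auto intro: sum_nonneg)

lemma closed_H0: "closed (H0 B)"
proof -
  have "H0 B = (\<Inter>u\<in>B. {f. f $ u = 0})"
    by (auto simp: H0_def)
  then show ?thesis
    by (auto intro!: closed_INT closed_Collect_eq continuous_intros)
qed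
lemma le_genus_iff:
  assumes "A \<noteq> {}"
  shows "enat k \<le> genus A \<longleftrightarrow> (\<forall>h \<phi>. continuous_on A \<phi> \<and> \<phi> ` A \<subseteq> punctured_space h \<and>
     (\<forall>x\<in>A. \<phi> (- x) = (\<lambda>i. - \<phi> x i)) \<longrightarrow> k \<le> h)"
proof -
  have *: "continuous_map (top_of_set A) (subtopology (Euclidean_space h) (- {\<lambda>_. 0})) \<phi> \<longleftrightarrow>
     continuous_on A \<phi> \<and> \<phi> ` A \<subseteq> punctured_space h" for h \<phi>
    by (auto simp: Euclidean_space_def euclidean_product_topology continuous_map_in_subtopology
        punctured_space_def subtopology_subtopology)
  have "enat k \<le> Inf {enat h | h. P h} \<longleftrightarrow> (\<forall>h. P h \<longrightarrow> k \<le> h)" for P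
    by (auto simp: le_Inf_iff)
  then show ?thesis
    unfolding genus_def * using assms by simp
qed

section \<open>Packings bound the variational eigenvalues\<close>

context connected_weighted_graph
begin

text \<open>
  On the unit sphere the quotient is the gradient norm, so a bound on the edge differences is all
  that is required.
\<close>
lemma rayleigh_powr_le:
  assumes p: "p > 0" and f: "f \<in> p_sphere B p"
    and M: "\<And>u v. (u, v) \<in> E \<Longrightarrow> \<bar>w u v * (f $ v - f $ u)\<bar> \<le> M"
  shows "rayleigh E w p f powr p \<le> card E / 2 * M powr p"
proof -
  have "rayleigh E w p f powr p = 1 / 2 * (\<Sum>(u, v)\<in>E. \<bar>w u v * (f $ v - f $ u)\<bar> powr p)"
    using f p by (simp add: rayleigh_def p_sphere_def grad_norm_powr)
  also have "\<dots> \<le> 1 / 2 * (\<Sum>(u, v)\<in>E. M powr p)"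
    using M p by (intro mult_left_mono sum_mono) (auto intro: powr_mono2)
  finally show ?thesis by (simp add: case_prod_unfold)
qed

text \<open>
  Real suprema are meaningful only for sets that are bounded above. So the sign of
  the variational eigenvalue, and its bound by a single admissible set, depend on this lemma.
\<close>
lemma bdd_above_rayleigh:
  assumes p: "p > 0" and A: "A \<subseteq> p_sphere B p"
  shows "bdd_above ((\<lambda>f. rayleigh E w p f powr p) ` A)"
proof (rule bdd_aboveI2)
  define W where "W = (\<Sum>(u, v)\<in>E. 2 * w u v)"
  have W: "2 * w u v \<le> W" if "(u, v) \<in> E" for u v
    unfolding W_def using member_le_sum[of "(u, v)" E "\<lambda>(u, v). 2 * w u v"] that w_pos
    by (force intro: less_imp_le)
  fix f assume "f \<in> A"
  with A have f: "f \<in> p_sphere B p" by blast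
  show "rayleigh E w p f powr p \<le> card E / 2 * W powr p"
  proof (rule rayleigh_powr_le[OF p f])
    fix u v assume e: "(u, v) \<in> E"
    have "\<bar>f $ u\<bar> \<le> 1" "\<bar>f $ v\<bar> \<le> 1"
      using abs_le_p_norm[OF p, of f] f by (auto simp: p_sphere_def)
    then have "\<bar>w u v * (f $ v - f $ u)\<bar> \<le> w u v * 2"
      using w_pos[OF e] by (auto simp: abs_mult intro!: mult_left_mono)
    with W[OF e] show "\<bar>w u v * (f $ v - f $ u)\<bar> \<le> W" by simp
  qed
qed

lemma genus_family_nonempty: "1 \<le> k \<Longrightarrow> A \<in> genus_family k S \<Longrightarrow> A \<noteq> {}"
  by (auto simp: genus_family_def genus_def zero_enat_def)

lemma SUP_rayleigh_nonneg:
  assumes p: "p > 0" and k: "1 \<le> k" and A: "A \<in> genus_family k (p_sphere B p)"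
  shows "0 \<le> (SUP f\<in>A. rayleigh E w p f powr p)"
proof -
  obtain f where "f \<in> A" using genus_family_nonempty[OF k A] by blast
  moreover have "A \<subseteq> p_sphere B p" using A by (simp add: genus_family_def)
  ultimately show ?thesis
    by (intro cSUP_upper2[OF bdd_above_rayleigh[OF p]]) auto
qed

lemma variational_eigenvalue_le:
  assumes p: "p > 0" and k: "1 \<le> k" and A: "A \<in> genus_family k (p_sphere B p)"
    and M: "\<And>f. f \<in> A \<Longrightarrow> rayleigh E w p f powr p \<le> M"
  shows "0 \<le> variational_eigenvalue E w B p k" "variational_eigenvalue E w B p k \<le> M"
proof -
  show "0 \<le> variational_eigenvalue E w B p k"
    unfolding variational_eigenvalue_def using A SUP_rayleigh_nonneg[OF p k]
    by (intro cINF_greatest) auto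
  have "variational_eigenvalue E w B p k \<le> (SUP f\<in>A. rayleigh E w p f powr p)"
    unfolding variational_eigenvalue_def using A
    by (intro cINF_lower bdd_belowI2[where m = 0] SUP_rayleigh_nonneg[OF p k])
  also have "\<dots> \<le> M"
    using genus_family_nonempty[OF k A] M by (intro cSUP_least)
  finally show "variational_eigenvalue E w B p k \<le> M" .
qed

definition packing :: "nat \<Rightarrow> real \<Rightarrow> (nat \<Rightarrow> 'v) \<Rightarrow> bool" where
  "packing m r u \<longleftrightarrow> (\<forall>i\<in>{1..m}. u i \<in> - B) \<and>
     (\<forall>i\<in>{1..m}. \<forall>j\<in>{1..m}. i \<noteq> j \<longrightarrow> graph_dist E w (u i) (u j) \<ge> ereal (2 * r)) \<and>
     (\<forall>i\<in>{1..m}. boundary_dist E w B (u i) \<ge> ereal r)"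

lemma packing_radius_eq: "packing_radius E w B m = Sup {ereal r | r. r > 0 \<and> (\<exists>u. packing m r u)}"
  unfolding packing_radius_def packing_def ..

text \<open>
  The admissible set \<open>A\<close> is the unit sphere of the span of the tents. It is written as the set of
  \<open>f\<close> that agree with the combination of tents whose coefficients are read off at the
  centres, where each tent has height \<open>r\<close>; this makes closedness evident. The map \<open>N\<close> from
  the sphere of coefficients to \<open>A\<close> is odd, so an odd map from \<open>A\<close> to a punctured \<open>\<real>\<^sup>h\<close> forces
  \<open>k \<le> h\<close> by the Borsuk-Ulam theorem.
\<close>
lemma variational_eigenvalue_le_packing:
  assumes p: "1 < p" and k: "1 \<le> k" "k \<le> CARD('v)" and r: "r > 0" and pack: "packing k r a"
  shows "0 \<le> variational_eigenvalue E w B p k"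
    "variational_eigenvalue E w B p k \<le> card E / 2 * (1 / r) powr p"
proof -
  have p0: "p > 0" using p by simp
  \<comment> \<open>Centres are numbered from \<open>1\<close>, coordinates of sequences from \<open>0\<close>.\<close>
  define t where "t = (\<lambda>i u. tent E w r (a (Suc i)) u)"
  have t_self: "t i (a (Suc i)) = r" for i
    using r by (simp add: t_def tent_self)
  have sep: "ereal (2 * r) \<le> graph_dist E w (a (Suc i)) (a (Suc j))" if "i < k" "j < k" "i \<noteq> j" for i j
    using pack that by (auto simp: packing_def)
  have t_nonneg: "t i u \<ge> 0" for i u by (simp add: t_def tent_nonneg)
  have t_sep: "t i u + t j v \<le> inverse (w u v)"
    if "i < k" "j < k" "i \<noteq> j" "(u, v) \<in> E" "t i u > 0" "t j v > 0" for i j u v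
    using tents_separated[OF sep[OF that(1-3)] walk_edge[OF that(4)]] that unfolding t_def by blast
  have t_disj: "t i u = 0 \<or> t j u = 0" if "i < k" "j < k" "i \<noteq> j" for i j u
  proof (rule ccontr)
    assume "\<not> ?thesis"
    then have "t i u > 0" "t j u > 0" using t_nonneg by (auto simp: less_le)
    then show False
      using tents_separated[OF sep[OF that] walk.walk_refl, of u] unfolding t_def by linarith
  qed
  define F :: "(nat \<Rightarrow> real) \<Rightarrow> real ^ 'v" where "F = (\<lambda>c. \<chi> u. \<Sum>i<k. c i * t i u)"
  have F_at: "F c $ a (Suc i) = c i * r" if "i < k" for c i
  proof -
    have "F c $ a (Suc i) = (\<Sum>j\<in>{i}. c j * t j (a (Suc i)))"
      unfolding F_def vec_lambda_beta
      by (rule sum.mono_neutral_right) (use that t_disj[of i _ "a (Suc i)"] t_self[of i] r in force)+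
    then show ?thesis by (simp add: t_self)
  qed
  have F_scale: "F (\<lambda>i. s * c i) = s *\<^sub>R F c" for s c
    by (simp add: F_def vec_eq_iff sum_distrib_left mult.assoc)
  have F_H0: "F c \<in> H0 B" for c
  proof -
    have "t i u = 0" if "u \<in> B" "i < k" for i u
    proof -
      have "ereal r \<le> boundary_dist E w B (a (Suc i))"
        using pack that by (auto simp: packing_def)
      also have "\<dots> \<le> graph_dist E w (a (Suc i)) u"
        unfolding boundary_dist_def by (rule INF_lower[OF that(1)])
      finally show ?thesis by (simp add: t_def tent_eq_0_iff)
    qed
    then show ?thesis by (simp add: H0_def F_def)
  qed
  \<comment> \<open>Either two different tents meet the edge, one at each end, or at most one tent is nonzero on
    it.\<close>
  have t_lip: "(\<Sum>i<k. \<bar>t i v - t i u\<bar>) \<le> inverse (w u v)" if e: "(u, v) \<in> E" for u v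
  proof -
    have lip: "\<bar>t i v - t i u\<bar> \<le> inverse (w u v)" for i
      using tent_edge[OF e] by (simp add: t_def abs_minus_commute)
    consider i j where "i < k" "j < k" "i \<noteq> j" "t i u > 0" "t j v > 0"
      | i where "i < k" "\<And>j. j < k \<Longrightarrow> j \<noteq> i \<Longrightarrow> t j u = 0 \<and> t j v = 0"
    proof (cases "\<exists>i<k. t i u > 0")
      case True
      then obtain i where i: "i < k" "t i u > 0" by blast
      show ?thesis
      proof (cases "\<exists>j<k. j \<noteq> i \<and> t j v > 0")
        case True
        then show ?thesis using i that(1)[of i] by blast
      next
        case False
        then have "t j u = 0 \<and> t j v = 0" if "j < k" "j \<noteq> i" for j
          using that i t_disj[of i j u] t_nonneg[of j v] by (force simp: less_le)
        then show ?thesis using i that(2) by blast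
      qed
    next
      case False
      then have u0: "t j u = 0" if "j < k" for j
        using that t_nonneg[of j u] by (force simp: less_le)
      show ?thesis
      proof (cases "\<exists>i<k. t i v > 0")
        case True
        then obtain i where i: "i < k" "t i v > 0" by blast
        then show ?thesis using that(2)[OF i(1)] u0 t_disj[of i _ v] by (metis less_irrefl)
      next
        case False
        then have "t j v = 0" if "j < k" for j
          using that t_nonneg[of j v] by (force simp: less_le)
        then show ?thesis using that(2)[of 0] k u0 by simp
      qed
    qed
    then show ?thesis
    proof cases
      case (1 i j)
      have "(\<Sum>l<k. \<bar>t l v - t l u\<bar>) = (\<Sum>l\<in>{i, j}. \<bar>t l v - t l u\<bar>)"
        by (rule sum.mono_neutral_right) (use 1 t_disj[of i _ u] t_disj[of j _ v] in force)+
      also have "\<dots> = t i u + t j v"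
        using 1 t_disj[of i j u] t_disj[of i j v] by auto
      also have "\<dots> \<le> inverse (w u v)"
        using 1 e by (intro t_sep)
      finally show ?thesis .
    next
      case (2 i)
      have "(\<Sum>l<k. \<bar>t l v - t l u\<bar>) = (\<Sum>l\<in>{i}. \<bar>t l v - t l u\<bar>)"
        by (rule sum.mono_neutral_right) (use 2 in auto)
      then show ?thesis using lip by simp
    qed
  qed
  have F_grad: "\<bar>w u v * (F c $ v - F c $ u)\<bar> \<le> M"
    if e: "(u, v) \<in> E" and M: "\<And>i. i < k \<Longrightarrow> \<bar>c i\<bar> \<le> M" for c M u v
  proof -
    have M0: "M \<ge> 0" using M[of 0] k by simp
    have "\<bar>F c $ v - F c $ u\<bar> = \<bar>\<Sum>i<k. c i * (t i v - t i u)\<bar>"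
      by (simp add: F_def sum_subtractf right_diff_distrib)
    also have "\<dots> \<le> (\<Sum>i<k. M * \<bar>t i v - t i u\<bar>)"
      by (rule order_trans[OF sum_abs]) (auto simp: abs_mult intro!: sum_mono mult_right_mono M)
    also have "\<dots> \<le> M * inverse (w u v)"
      using t_lip[OF e] M0 by (simp add: mult_left_mono flip: sum_distrib_left)
    finally have "w u v * \<bar>F c $ v - F c $ u\<bar> \<le> w u v * (M * inverse (w u v))"
      using w_pos[OF e] by (intro mult_left_mono) auto
    also have "\<dots> = M" using w_pos[OF e] by simp
    finally show ?thesis using w_pos[OF e] by (simp add: abs_mult)
  qed
  define A where "A = {f \<in> p_sphere B p. f = F (\<lambda>i. f $ a (Suc i) / r)}"
  have F_coord: "F (\<lambda>i. F c $ a (Suc i) / r) = F c" for c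
    using r by (simp add: F_def vec_eq_iff F_at[unfolded F_def, simplified])
  have bound: "rayleigh E w p f powr p \<le> card E / 2 * (1 / r) powr p" if "f \<in> A" for f
  proof (rule rayleigh_powr_le[OF p0])
    show "f \<in> p_sphere B p" using that by (simp add: A_def)
    then have coord: "\<bar>f $ a (Suc i) / r\<bar> \<le> 1 / r" for i
      using abs_le_p_norm[OF p0, of f "a (Suc i)"] r by (simp add: p_sphere_def divide_right_mono)
    have "F (\<lambda>i. f $ a (Suc i) / r) = f"
      using that by (simp add: A_def)
    then show "\<bar>w u v * (f $ v - f $ u)\<bar> \<le> 1 / r" if "(u, v) \<in> E" for u v
      using F_grad[where c = "\<lambda>i. f $ a (Suc i) / r", OF that coord] by simp
  qed
  define N where "N = (\<lambda>c. F c /\<^sub>R p_norm p (F c))"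
  let ?S = "topspace (nsphere (k - 1))"
  have F_nz: "F c \<noteq> 0" if "c \<in> ?S" for c
  proof
    assume "F c = 0"
    then have "c i = 0" if "i < k" for i
      using F_at[OF that, of c] r by simp
    then have "c = (\<lambda>_. 0)"
      using that k by (auto simp: topspace_nsphere fun_eq_iff not_less)
    then show False
      using nsphere_subset_punctured that by (auto simp: punctured_space_def)
  qed
  have N_A: "N c \<in> A" if "c \<in> ?S" for c
  proof -
    have pos: "p_norm p (F c) > 0" using p_norm_pos[OF p0 F_nz[OF that]] .
    have eq: "N c = F (\<lambda>i. inverse (p_norm p (F c)) * c i)"
      by (simp add: N_def F_scale)
    have "p_norm p (N c) = 1"
      using pos by (simp add: N_def p_norm_scale[OF p0])
    then show ?thesis
      unfolding A_def p_sphere_def using eq F_H0 F_coord by simp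
  qed
  have N_minus: "N (\<lambda>i. - c i) = - N c" for c
  proof -
    have "F (\<lambda>i. - c i) = - F c" using F_scale[of "-1" c] by simp
    then show ?thesis
      using p_norm_scale[OF p0, of "-1" "F c"] by (simp add: N_def)
  qed
  have F_cont: "continuous_on X (\<lambda>x. F (q x))" if "\<And>i. continuous_on X (\<lambda>x. q x i)"
    for X :: "'b::topological_space set" and q
    unfolding F_def by (intro continuous_on_vec_lambda continuous_intros that)
  have N_cont: "continuous_on ?S N"
  proof -
    have "continuous_on ?S F"
      by (rule F_cont, rule continuous_on_product_then_coordinatewise, rule continuous_on_id)
    moreover have "p_norm p (F c) \<noteq> 0" if "c \<in> ?S" for c
      using p_norm_pos[OF p0 F_nz[OF that]] by simp
    ultimately show ?thesis
      unfolding N_def by (intro continuous_intros continuous_on_p_norm[OF p0]) auto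
  qed
  have A_ne: "A \<noteq> {}" using N_A in_topspace_nsphere by blast
  have "A \<in> genus_family k (p_sphere B p)"
    unfolding genus_family_def
  proof (intro CollectI conjI)
    show "A \<subseteq> p_sphere B p" by (auto simp: A_def)
    have "A = H0 B \<inter> {f. p_norm p f = 1} \<inter> {f. f = F (\<lambda>i. f $ a (Suc i) / r)}"
      by (auto simp: A_def p_sphere_def)
    moreover have "closed {f :: real ^ 'v. p_norm p f = 1}"
      by (intro closed_Collect_eq continuous_intros continuous_on_p_norm[OF p0])
    moreover have "closed {f. f = F (\<lambda>i. f $ a (Suc i) / r)}"
      using r by (intro closed_Collect_eq continuous_intros F_cont) auto
    ultimately show "closed A" by (simp add: closed_H0 closed_Int)
    have "- f \<in> A" if "f \<in> A" for f
    proof -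
      have "p_norm p (- f) = p_norm p f" using p_norm_scale[OF p0, of "-1" f] by simp
      moreover have "F (\<lambda>i. - (f $ a (Suc i) / r)) = - F (\<lambda>i. f $ a (Suc i) / r)"
        using F_scale[of "-1"] by simp
      ultimately show ?thesis using that by (simp add: A_def p_sphere_def H0_def)
    qed
    then show "uminus ` A = A" by force
    show "enat k \<le> genus A"
      unfolding le_genus_iff[OF A_ne]
    proof clarify
      fix h \<phi> assume \<phi>: "continuous_on A \<phi>" "\<phi> ` A \<subseteq> punctured_space h"
        "\<forall>x\<in>A. \<phi> (- x) = (\<lambda>i. - \<phi> x i)"
      have "k - 1 < h"
      proof (rule Borsuk_Ulam_odd_map[where 'a = "real ^ 'v"])
        show "k - 1 < DIM(real ^ 'v)" using k by simp
        show "continuous_on ?S (\<lambda>c. \<phi> (N c))"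
          by (rule continuous_on_compose2[OF \<phi>(1) N_cont]) (use N_A in auto)
      qed (use \<phi> N_A N_minus in auto)
      then show "k \<le> h" by simp
    qed
  qed
  from variational_eigenvalue_le[OF p0 k(1) this bound]
  show "0 \<le> variational_eigenvalue E w B p k"
    "variational_eigenvalue E w B p k \<le> card E / 2 * (1 / r) powr p" by blast+
qed

end

section \<open>Nodal domains\<close>
lemma connected_on_singleton: "connected_on E {u}"
  by (simp add: connected_on_def)

lemma connected_on_Un:
  assumes "sym E" "connected_on E U" "connected_on E W" "u \<in> U" "v \<in> W" "u = v \<or> (u, v) \<in> E"
  shows "connected_on E (U \<union> W)"
proof -
  let ?R = "(E \<inter> (U \<union> W) \<times> (U \<union> W))\<^sup>*"
  have "(E \<inter> U \<times> U)\<^sup>* \<subseteq> ?R" "(E \<inter> W \<times> W)\<^sup>* \<subseteq> ?R"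
    by (intro rtrancl_mono; blast)+
  then have U: "\<And>x y. x \<in> U \<Longrightarrow> y \<in> U \<Longrightarrow> (x, y) \<in> ?R"
    and W: "\<And>x y. x \<in> W \<Longrightarrow> y \<in> W \<Longrightarrow> (x, y) \<in> ?R"
    using assms(2,3) unfolding connected_on_def by blast+
  have "(v, u) \<in> E \<or> u = v" using assms(1,6) by (auto simp: sym_def)
  then have uv: "(u, v) \<in> ?R" "(v, u) \<in> ?R"
    using assms(4-6) by auto
  show ?thesis
    unfolding connected_on_def
  proof (intro ballI)
    fix x y assume "x \<in> U \<union> W" "y \<in> U \<union> W"
    then show "(x, y) \<in> ?R"
      using U W uv assms(4,5) by (elim UnE) (blast intro: rtrancl_trans)+
  qed
qed

lemma nodal_domain_exists:
  assumes "f $ u \<noteq> 0"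
  shows "\<exists>U\<in>nodal_domains E f. u \<in> U"
proof -
  have "sign_connected E f {u}"
    using assms by (cases "f $ u > 0") (auto simp: sign_connected_def connected_on_singleton)
  then have "\<exists>U\<in>{U. sign_connected E f U}. {u} \<subseteq> U \<and> (\<forall>W\<in>{U. sign_connected E f U}. U \<subseteq> W \<longrightarrow> U = W)"
    by (intro finite_has_maximal2[OF finite]) simp
  then obtain U where "sign_connected E f U" "u \<in> U" "\<And>W. sign_connected E f W \<Longrightarrow> U \<subseteq> W \<Longrightarrow> U = W"
    by auto
  then have "U \<in> nodal_domains E f"
    unfolding nodal_domains_def by simp metis
  with \<open>u \<in> U\<close> show ?thesis by blast
qed

lemma nodal_domain_sign: "U \<in> nodal_domains E f \<Longrightarrow> u \<in> U \<Longrightarrow> v \<in> U \<Longrightarrow> 0 < f $ u * f $ v"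
  unfolding nodal_domains_def sign_connected_def by (auto simp: mult_neg_neg)

lemma nodal_domain_nonempty: "U \<in> nodal_domains E f \<Longrightarrow> U \<noteq> {}"
  unfolding nodal_domains_def sign_connected_def by auto

text \<open>
  Taking \<open>u = v\<close>, nodal domains are disjoint; taking an edge, different nodal domains of the
  same sign are not adjacent. In both cases the union would be a larger sign-connected set.
\<close>
lemma nodal_domain_unique:
  assumes "sym E" "U \<in> nodal_domains E f" "W \<in> nodal_domains E f" "u \<in> U" "v \<in> W"
    and "u = v \<or> (u, v) \<in> E" "0 < f $ u * f $ v"
  shows "U = W"
proof -
  have U: "sign_connected E f U" and W: "sign_connected E f W"
    using assms by (auto simp: nodal_domains_def)
  have "sign_connected E f (U \<union> W)"
    unfolding sign_connected_def
  proof (intro conjI)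
    show "connected_on E (U \<union> W)"
      using U W assms by (intro connected_on_Un) (auto simp: sign_connected_def)
    have "0 < f $ u \<and> 0 < f $ v \<or> f $ u < 0 \<and> f $ v < 0"
      using assms(7) by (simp add: zero_less_mult_iff)
    then show "(\<forall>x\<in>U \<union> W. 0 < f $ x) \<or> (\<forall>x\<in>U \<union> W. f $ x < 0)"
      using U W assms(4,5) unfolding sign_connected_def by (metis UnE less_asym)
  qed (use assms in auto)
  then have "U \<union> W = U" "U \<union> W = W"
    using assms(2,3) unfolding nodal_domains_def by auto
  then show ?thesis by simp
qed

text \<open>
  The factor \<open>a\<close> is the reciprocal of the maximum modulus of \<open>f\<close> on the nodal domain, and \<open>0\<close> where \<open>f\<close>
  vanishes. Constancy on a nodal domain is expressed through edges, because the later estimates are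
  made edge by edge.
\<close>
lemma nodal_normalization:
  fixes f :: "real ^ 'v::finite"
  assumes "sym E"
  obtains a :: "'v \<Rightarrow> real" where
    "\<And>u. a u \<ge> 0" "\<And>u. f $ u = 0 \<Longrightarrow> a u = 0"
    "\<And>u v. (u, v) \<in> E \<Longrightarrow> 0 < f $ u * f $ v \<Longrightarrow> a u = a v"
    "\<And>u. \<bar>a u * f $ u\<bar> \<le> 1"
    "\<And>U. U \<in> nodal_domains E f \<Longrightarrow> \<exists>u\<in>U. \<bar>a u * f $ u\<bar> = 1"
proof -
  have "\<forall>u. \<exists>U. f $ u \<noteq> 0 \<longrightarrow> U \<in> nodal_domains E f \<and> u \<in> U"
    using nodal_domain_exists by blast
  then obtain D where D: "\<And>u. f $ u \<noteq> 0 \<Longrightarrow> D u \<in> nodal_domains E f \<and> u \<in> D u"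
    by metis
  define M where "M = (\<lambda>u. Max ((\<lambda>v. \<bar>f $ v\<bar>) ` D u))"
  have M: "\<bar>f $ u\<bar> \<le> M u" if "f $ u \<noteq> 0" for u
    unfolding M_def using D[OF that] by (intro Max_ge) auto
  define a where "a = (\<lambda>u. if f $ u = 0 then 0 else 1 / M u)"
  show thesis
  proof
    show "a u \<ge> 0" for u
      using M[of u] by (auto simp: a_def)
    show "a u = 0" if "f $ u = 0" for u
      using that by (simp add: a_def)
    show "a u = a v" if "(u, v) \<in> E" "0 < f $ u * f $ v" for u v
    proof -
      have nz: "f $ u \<noteq> 0" "f $ v \<noteq> 0" using that by auto
      have "D u = D v"
        using D[OF nz(1)] D[OF nz(2)] that by (intro nodal_domain_unique[OF assms, of _ f _ u v]) auto
      then show ?thesis using nz by (simp add: a_def M_def)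
    qed
    show "\<bar>a u * f $ u\<bar> \<le> 1" for u
      using M[of u] by (auto simp: a_def abs_mult divide_simps)
    show "\<exists>u\<in>U. \<bar>a u * f $ u\<bar> = 1" if U: "U \<in> nodal_domains E f" for U
    proof -
      have "Max ((\<lambda>v. \<bar>f $ v\<bar>) ` U) \<in> (\<lambda>v. \<bar>f $ v\<bar>) ` U"
        using nodal_domain_nonempty[OF U] by (intro Max_in) auto
      then obtain u where u: "u \<in> U" "\<bar>f $ u\<bar> = Max ((\<lambda>v. \<bar>f $ v\<bar>) ` U)" by force
      have nz: "f $ u \<noteq> 0" using nodal_domain_sign[OF U u(1) u(1)] by auto
      have "D u = U"
        using D[OF nz] U u nodal_domain_sign[OF U u(1) u(1)]
        by (intro nodal_domain_unique[OF assms, of _ f _ u u]) auto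
      then have "M u = \<bar>f $ u\<bar>" using u by (simp add: M_def)
      then show ?thesis using nz u(1) by (intro bexI[of _ u]) (auto simp: a_def abs_mult)
    qed
  qed
qed

context connected_weighted_graph
begin

text \<open>
  A walk that never meets the value \<open>0\<close> or the opposite sign cannot leave the nodal domain in
  which it starts, because adjacent nodes of equal sign belong to the same nodal domain.
\<close>
lemma walk_leaves_nodal_domain:
  assumes "walk E w u l v" "f $ u \<noteq> 0"
  shows "(\<exists>U\<in>nodal_domains E f. u \<in> U \<and> v \<in> U) \<or>
    (\<exists>z l1 l2. walk E w u l1 z \<and> walk E w z l2 v \<and> l = l1 + l2 \<and> f $ z * f $ u \<le> 0)"
  using assms
proof induction
  case walk_refl
  then show ?case using nodal_domain_exists[of f u E] by blast
next
  case (walk_step l v z)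
  from walk_step.IH[OF walk_step.prems] show ?case
  proof
    assume "\<exists>U\<in>nodal_domains E f. u \<in> U \<and> v \<in> U"
    then obtain U where U: "U \<in> nodal_domains E f" "u \<in> U" "v \<in> U" by blast
    have walk: "walk E w u (l + inverse (w v z)) z"
      using walk_step.hyps by (rule walk.walk_step)
    show ?case
    proof (cases "f $ z * f $ u \<le> 0")
      case True
      then show ?thesis using walk walk.walk_refl[of E w z] by force
    next
      case False
      have "0 < f $ u * f $ v" by (rule nodal_domain_sign[OF U])
      with False have vz: "0 < f $ v * f $ z" "f $ z \<noteq> 0"
        by (auto simp: zero_less_mult_iff not_le)
      then obtain W where W: "W \<in> nodal_domains E f" "z \<in> W"
        using nodal_domain_exists by blast
      have "U = W"
        using nodal_domain_unique[OF sym_E U(1) W(1) U(3) W(2) _ vz(1)] walk_step.hyps by blast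
      then show ?thesis using U W by blast
    qed
  next
    assume "\<exists>y l1 l2. walk E w u l1 y \<and> walk E w y l2 v \<and> l = l1 + l2 \<and> f $ y * f $ u \<le> 0"
    then obtain y l1 l2 where y: "walk E w u l1 y" "walk E w y l2 v" "l = l1 + l2" "f $ y * f $ u \<le> 0"
      by blast
    have "walk E w y (l2 + inverse (w v z)) z"
      using y(2) walk_step.hyps(2) by (rule walk.walk_step)
    then show ?case using y by (metis add.assoc)
  qed
qed

lemma walk_lipschitz:
  assumes lip: "\<And>u v. (u, v) \<in> E \<Longrightarrow> w u v * \<bar>g v - g u\<bar> \<le> \<Lambda>" and r: "r > 0" "r * \<Lambda> \<le> 1"
    and "walk E w u l v"
  shows "r * \<bar>g u - g v\<bar> \<le> l"
  using assms(4)
proof induction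
  case (walk_step l v z)
  have "r * (w v z * \<bar>g z - g v\<bar>) \<le> 1"
    using mult_left_mono[OF lip[OF walk_step.hyps(2)], of r] r by linarith
  then have "r * \<bar>g z - g v\<bar> \<le> inverse (w v z)"
    using w_pos[OF walk_step.hyps(2)] by (simp add: field_simps)
  moreover have "r * \<bar>g u - g z\<bar> \<le> r * (\<bar>g u - g v\<bar> + \<bar>g z - g v\<bar>)"
    using r by (intro mult_left_mono) auto
  ultimately show ?case using walk_step.IH by (simp add: distrib_left)
qed simp

text \<open>
  The rescaled function has modulus \<open>1\<close> at the chosen nodes and changes by at most \<open>l / r\<close> along a walk
  of length \<open>l\<close>. The condition \<open>r * \<Lambda> \<le> 1\<close> replaces \<open>r = 1/\<Lambda>\<close> in order to include \<open>\<Lambda> = 0\<close>, where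
  every radius is admissible.
\<close>
lemma packing_nodal_domains:
  assumes f: "f \<in> H0 B"
    and a: "\<And>u. a u \<ge> 0" "\<And>U. U \<in> nodal_domains E f \<Longrightarrow> \<exists>u\<in>U. \<bar>a u * f $ u\<bar> = 1"
    and lip: "\<And>u v. (u, v) \<in> E \<Longrightarrow> w u v * \<bar>a v * f $ v - a u * f $ u\<bar> \<le> \<Lambda>"
    and r: "r > 0" "r * \<Lambda> \<le> 1"
  shows "\<exists>x. packing (card (nodal_domains E f)) r x"
proof -
  let ?m = "card (nodal_domains E f)"
  define g where "g = (\<lambda>u. a u * f $ u)"
  have walk_g: "r * \<bar>g u - g v\<bar> \<le> l" if "walk E w u l v" for u l v
    by (rule walk_lipschitz[OF _ r that]) (use lip in \<open>simp add: g_def\<close>)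
  have "finite (nodal_domains E f)" by (rule finite)
  then obtain D where D: "bij_betw D {1..?m} (nodal_domains E f)"
    using ex_bij_betw_nat_finite_1 by blast
  have D_nodal: "D i \<in> nodal_domains E f" if "i \<in> {1..?m}" for i
    using D that by (auto simp: bij_betw_def)
  then have "\<forall>i\<in>{1..?m}. \<exists>u. u \<in> D i \<and> \<bar>g u\<bar> = 1"
    using a(2) unfolding g_def by blast
  then obtain x where x: "\<And>i. i \<in> {1..?m} \<Longrightarrow> x i \<in> D i \<and> \<bar>g (x i)\<bar> = 1"
    by metis
  \<comment> \<open>On the way to a node where \<open>f\<close> vanishes or has the other sign, \<open>g\<close> changes by at least \<open>1\<close>.\<close>
  have opp: "1 \<le> \<bar>g u - g z\<bar>" if "\<bar>g u\<bar> = 1" "f $ z * f $ u \<le> 0" for u z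
  proof -
    have "g z * g u = (a z * a u) * (f $ z * f $ u)" by (simp add: g_def)
    also have "\<dots> \<le> 0" using that a(1) by (simp add: mult_nonneg_nonpos)
    finally show ?thesis using that(1) by (cases "g u = 1") (auto simp: abs_if split: if_splits)
  qed
  have "packing ?m r x"
    unfolding packing_def
  proof (intro conjI ballI impI)
    fix i assume i: "i \<in> {1..?m}"
    show "x i \<in> - B"
      using x[OF i] f by (auto simp: g_def H0_def)
    show "ereal r \<le> boundary_dist E w B (x i)"
      unfolding boundary_dist_def
    proof (rule INF_greatest)
      fix b assume "b \<in> B"
      then have "g b = 0" using f by (simp add: g_def H0_def)
      then show "ereal r \<le> graph_dist E w (x i) b"
        unfolding le_graph_dist_iff using walk_g[of "x i" _ b] x[OF i] by auto
    qed
  next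
    fix i j assume i: "i \<in> {1..?m}" and j: "j \<in> {1..?m}" and ij: "i \<noteq> j"
    show "ereal (2 * r) \<le> graph_dist E w (x i) (x j)"
      unfolding le_graph_dist_iff
    proof clarify
      fix l assume walk: "walk E w (x i) l (x j)"
      have nz: "f $ x i \<noteq> 0" using x[OF i] by (auto simp: g_def)
      have "D i \<noteq> D j" using bij_betw_imp_inj_on[OF D] i j ij by (metis inj_onD)
      from walk_leaves_nodal_domain[OF walk nz] show "ereal (2 * r) \<le> ereal l"
      proof
        assume "\<exists>U\<in>nodal_domains E f. x i \<in> U \<and> x j \<in> U"
        then obtain U where U: "U \<in> nodal_domains E f" "x i \<in> U" "x j \<in> U" by blast
        have "D i = U" "D j = U"
          using nodal_domain_unique[OF sym_E D_nodal[OF i] U(1), of "x i" "x i"]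
            nodal_domain_unique[OF sym_E D_nodal[OF j] U(1), of "x j" "x j"] U x[OF i] x[OF j]
            nodal_domain_sign[OF U(1)] by blast+
        with \<open>D i \<noteq> D j\<close> show ?thesis by simp
      next
        assume "\<exists>z l1 l2. walk E w (x i) l1 z \<and> walk E w z l2 (x j) \<and> l = l1 + l2 \<and> f $ z * f $ x i \<le> 0"
        then obtain z l1 l2 where z: "walk E w (x i) l1 z" "walk E w z l2 (x j)" "l = l1 + l2"
          "f $ z * f $ x i \<le> 0" by blast
        have gi: "\<bar>g (x i)\<bar> = 1" and gj: "\<bar>g (x j)\<bar> = 1" using x i j by auto
        have 1: "1 \<le> \<bar>g (x i) - g z\<bar>" by (rule opp[OF gi z(4)])
        have "2 \<le> \<bar>g (x i) - g z\<bar> + \<bar>g z - g (x j)\<bar>"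
        proof (cases "g (x i) = g (x j)")
          case True
          with 1 show ?thesis by (simp add: abs_minus_commute)
        next
          case False
          then have "\<bar>g (x i) - g (x j)\<bar> = 2" using gi gj by (auto simp: abs_if split: if_splits)
          then show ?thesis by linarith
        qed
        then have "r * 2 \<le> r * \<bar>g (x i) - g z\<bar> + r * \<bar>g z - g (x j)\<bar>"
          using r(1) by (simp flip: distrib_left)
        also have "\<dots> \<le> l" using walk_g[OF z(1)] walk_g[OF z(2)] z(3) by simp
        finally show ?thesis by simp
      qed
    qed
  qed
  then show ?thesis by blast
qed

lemma packing_exists:
  assumes "k \<le> card (- B)"
  shows "\<exists>r>0. \<exists>u. packing k r u"
proof -
  obtain \<delta> where \<delta>: "\<delta> > 0" "\<And>u v. u \<noteq> v \<Longrightarrow> ereal \<delta> \<le> graph_dist E w u v"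
    using graph_dist_bounded_below by blast
  have "card {1..k} \<le> card (- B)" using assms by simp
  then obtain u where u: "u ` {1..k} \<subseteq> - B" "inj_on u {1..k}"
    using card_le_inj[of "{1..k}" "- B"] by auto
  have "packing k (\<delta> / 2) u"
    unfolding packing_def
  proof (intro conjI ballI impI)
    show "u i \<in> - B" if "i \<in> {1..k}" for i using u that by blast
    show "ereal (2 * (\<delta> / 2)) \<le> graph_dist E w (u i) (u j)" if "i \<in> {1..k}" "j \<in> {1..k}" "i \<noteq> j" for i j
    proof -
      have "u i \<noteq> u j" using u(2) that by (metis inj_onD)
      then show ?thesis using \<delta>(2) by simp
    qed
    show "ereal (\<delta> / 2) \<le> boundary_dist E w B (u i)" if "i \<in> {1..k}" for i
      unfolding boundary_dist_def
    proof (rule INF_greatest)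
      fix b assume "b \<in> B"
      then have "u i \<noteq> b" using u that by blast
      from \<delta>(2)[OF this] show "ereal (\<delta> / 2) \<le> graph_dist E w (u i) b"
        using \<delta>(1) by (intro order_trans[OF _ \<delta>(2)[OF \<open>u i \<noteq> b\<close>]]) simp
    qed
  qed
  then show ?thesis using \<delta>(1) by (intro exI[of _ "\<delta> / 2"]) auto
qed

end

section \<open>Rescaling eigenfunctions\<close>

text \<open>
  Jensen's inequality for \<open>t powr p\<close> with weights \<open>x / (x + y)\<close> and \<open>y / (x + y)\<close>. Convexity is
  used on the positive half-line only, so vanishing \<open>a\<close> or \<open>b\<close> are treated directly.
\<close>
lemma power_mean_two:
  fixes a b x y p :: real
  assumes "p > 1" "a \<ge> 0" "b \<ge> 0" "x \<ge> 0" "y \<ge> 0"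
  shows "(a * x + b * y) powr p \<le> (x + y) powr (p - 1) * (a powr p * x + b powr p * y)"
proof -
  have one: "(c * u) powr p \<le> (u + v) powr (p - 1) * (c powr p * u)" if "c \<ge> 0" "u \<ge> 0" "v \<ge> 0" for c u v
  proof (cases "u = 0")
    case False
    have "(c * u) powr p = u powr (p - 1) * (c powr p * u)"
      using that False by (simp add: powr_mult powr_diff)
    also have "\<dots> \<le> (u + v) powr (p - 1) * (c powr p * u)"
      using that assms(1) by (intro mult_right_mono powr_mono2) auto
    finally show ?thesis .
  qed simp
  consider "a = 0" | "b = 0" | "x + y = 0" | "a > 0" "b > 0" "x + y > 0"
    using assms by linarith
  then show ?thesis
  proof cases
    case 1 then show ?thesis using one[of b y x] assms by (simp add: add.commute)
  next
    case 2 then show ?thesis using one[of a x y] assms by simp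
  next
    case 3 then show ?thesis using assms by (simp add: add_nonneg_eq_0_iff)
  next
    case 4
    define s where "s = x + y"
    have s: "s > 0" using 4 by (simp add: s_def)
    have x: "1 - y / s = x / s" using s by (simp add: s_def field_simps)
    have "((1 - y / s) *\<^sub>R a + (y / s) *\<^sub>R b) powr p \<le> (1 - y / s) * a powr p + (y / s) * b powr p"
      using assms s 4 by (intro convex_onD[OF powr_convex]) (auto simp: s_def)
    then have le: "((a * x + b * y) / s) powr p \<le> (a powr p * x + b powr p * y) / s"
      unfolding x by (simp add: add_divide_distrib mult.commute)
    have "(a * x + b * y) powr p = s powr p * ((a * x + b * y) / s) powr p"
      using s assms by (simp add: powr_divide)
    also have "\<dots> \<le> s powr p * ((a powr p * x + b powr p * y) / s)"
      by (intro mult_left_mono le) simp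
    also have "\<dots> = s powr (p - 1) * (a powr p * x + b powr p * y)"
      using s by (simp add: powr_diff)
    finally show ?thesis by (simp add: s_def)
  qed
qed

text \<open>Both sides vanish at \<open>d = 0\<close>, whatever the exponent, since \<open>0 powr q = 0\<close>.\<close>
lemma signed_powr_mult:
  fixes d :: real
  shows "\<bar>d\<bar> powr (p - 2) * d * d = \<bar>d\<bar> powr p"
proof (cases "d = 0")
  case False
  have "\<bar>d\<bar> powr (p - 2) * d * d = \<bar>d\<bar> powr (p - 2) * \<bar>d\<bar> powr 2"
    using False by (simp add: powr_numeral power2_eq_square)
  also have "\<dots> = \<bar>d\<bar> powr p"
    by (simp only: powr_add[symmetric]) simp
  finally show ?thesis .
qed simp

lemma signed_powr_abs:
  fixes d :: real
  assumes "d \<ge> 0"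
  shows "\<bar>d\<bar> powr (p - 2) * d = d powr (p - 1)"
proof (cases "d = 0")
  case False
  then have "\<bar>d\<bar> powr (p - 2) * d = d powr (p - 2) * d powr 1" using assms by simp
  also have "\<dots> = d powr (p - 1)" by (simp only: powr_add[symmetric]) simp
  finally show ?thesis .
qed simp

text \<open>
  The case \<open>x \<ge> 0\<close> of \<open>edge_inequality\<close>. For \<open>y \<le> 0\<close> the sign changes along the edge and Jensen's inequality
  applies. For \<open>b = 0\<close> the left-hand side is \<open>a powr p * x powr p\<close>, and \<open>p - 1\<close> of the \<open>p\<close> factors \<open>x\<close> are
  replaced by \<open>C * (x - y)\<close>.
\<close>
lemma edge_inequality_nonneg:
  fixes x y a b C p :: real
  assumes p: "p > 1" and ab: "a \<ge> 0" "b \<ge> 0" and C: "C \<ge> 1" and x: "x \<ge> 0"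
    and cases: "y \<le> 0 \<or> (b = 0 \<and> x \<le> C * (x - y))"
  shows "\<bar>a * x - b * y\<bar> powr p \<le> C powr p * (\<bar>x - y\<bar> powr (p - 2) * (x - y) * (a powr p * x - b powr p * y))"
  using cases
proof
  assume y: "y \<le> 0"
  have "0 \<le> a * x" "b * y \<le> 0"
    using x y ab by (auto intro: mult_nonneg_nonneg mult_nonneg_nonpos)
  then have "\<bar>a * x - b * y\<bar> = a * x + b * (- y)"
    by simp
  then have "\<bar>a * x - b * y\<bar> powr p \<le> (x + - y) powr (p - 1) * (a powr p * x + b powr p * (- y))"
    using power_mean_two[OF p ab x, of "- y"] y by simp
  also have "\<dots> = \<bar>x - y\<bar> powr (p - 2) * (x - y) * (a powr p * x - b powr p * y)"
    using signed_powr_abs[of "x - y" p] x y by simp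
  also have "\<dots> \<le> C powr p * \<dots>"
  proof -
    have "0 \<le> \<bar>x - y\<bar> powr (p - 2) * (x - y) * (a powr p * x - b powr p * y)"
      using x y by (intro mult_nonneg_nonneg) (auto simp: mult_nonneg_nonpos intro: order_trans[of _ 0])
    moreover have "1 \<le> C powr p" using C p by (simp add: ge_one_powr_ge_zero)
    ultimately show ?thesis using mult_right_mono by fastforce
  qed
  finally show ?thesis .
next
  assume b: "b = 0 \<and> x \<le> C * (x - y)"
  have d: "x - y \<ge> 0"
    using b x C by (smt (verit) mult_nonneg_nonpos zero_le_mult_iff)
  have "\<bar>a * x - b * y\<bar> powr p = a powr p * x powr p"
    using b ab x by (simp add: powr_mult)
  also have "x powr p = x powr (p - 1) * x"
    using signed_powr_mult[of x p] signed_powr_abs[OF x, of p] x by simp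
  also have "x powr (p - 1) \<le> (C * (x - y)) powr (p - 1)"
    using b x p by (intro powr_mono2) auto
  also have "\<dots> = C powr (p - 1) * (x - y) powr (p - 1)"
    using C d by (simp add: powr_mult)
  also have "C powr (p - 1) \<le> C powr p" using C by (intro powr_mono) auto
  finally have "\<bar>a * x - b * y\<bar> powr p \<le> a powr p * (C powr p * (x - y) powr (p - 1) * x)"
    using x by (simp add: mult_left_mono mult_right_mono)
  also have "\<dots> = C powr p * (\<bar>x - y\<bar> powr (p - 2) * (x - y) * (a powr p * x - b powr p * y))"
    using signed_powr_abs[OF d, of p] b p by simp
  finally show ?thesis .
qed

lemma edge_inequality_zero_right:
  fixes x y a b C p :: real
  assumes p: "p > 1" and ab: "a \<ge> 0" "b \<ge> 0" and C: "C \<ge> 1"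
    and cases: "x * y \<le> 0 \<or> (b = 0 \<and> \<bar>x\<bar> \<le> C * \<bar>x - y\<bar> \<and> 0 \<le> x * (x - y))"
  shows "\<bar>a * x - b * y\<bar> powr p \<le> C powr p * (\<bar>x - y\<bar> powr (p - 2) * (x - y) * (a powr p * x - b powr p * y))"
proof (cases "x > 0")
  case True
  then have "y \<le> 0 \<or> (b = 0 \<and> x \<le> C * (x - y))"
    using cases by (auto simp: mult_le_0_iff zero_le_mult_iff)
  then show ?thesis using True by (intro edge_inequality_nonneg assms) auto
next
  case False
  show ?thesis
  proof (cases "x < 0")
    case True
    have "x - y \<le> 0" if "0 \<le> x * (x - y)"
      using that True by (simp add: zero_le_mult_iff)
    then have "- y \<le> 0 \<or> (b = 0 \<and> - x \<le> C * (- x - (- y)))"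
      using cases True by (auto simp: mult_le_0_iff)
    from edge_inequality_nonneg[OF p ab C _ this] True
    have "\<bar>a * (- x) - b * (- y)\<bar> powr p \<le>
      C powr p * (\<bar>- x - - y\<bar> powr (p - 2) * (- x - - y) * (a powr p * - x - b powr p * - y))" by simp
    moreover have "\<bar>a * (- x) - b * (- y)\<bar> = \<bar>a * x - b * y\<bar>" "\<bar>- x - - y\<bar> = \<bar>x - y\<bar>" by auto
    moreover have "(- x - - y) * (a powr p * - x - b powr p * - y) = (x - y) * (a powr p * x - b powr p * y)"
      by (simp add: algebra_simps)
    ultimately show ?thesis by (simp only: mult.assoc)
  next
    case F: False
    with False have x: "x = 0" by simp
    show ?thesis
    proof (cases "y \<le> 0")
      case True
      then show ?thesis using x by (intro edge_inequality_nonneg assms) auto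
    next
      case y: False
      have "\<bar>a * - x - b * - y\<bar> powr p \<le>
        C powr p * (\<bar>- x - - y\<bar> powr (p - 2) * (- x - - y) * (a powr p * - x - b powr p * - y))"
        using x y by (intro edge_inequality_nonneg assms) auto
      then show ?thesis using x by simp
    qed
  qed
qed

text \<open>
  Here \<open>x\<close> and \<open>y\<close> are the values of an eigenfunction at the ends of an edge, and \<open>a\<close> and \<open>b\<close> are the
  factors by which they are rescaled. The right-hand side is, up to \<open>C powr p\<close> and the weight, the
  contribution of the edge when the eigenvalue equation is tested with \<open>a powr p * f\<close>. The four alternatives are:
  equal factors, a change of sign, and, from either end, an edge to a node where the factor
  is \<open>0\<close> and the eigenfunction is comparatively small.
\<close>
lemma edge_inequality:
  fixes x y a b C p :: real
  assumes p: "p > 1" and ab: "a \<ge> 0" "b \<ge> 0" and C: "C \<ge> 1"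
    and cases: "a = b \<or> x * y \<le> 0 \<or> (b = 0 \<and> \<bar>x\<bar> \<le> C * \<bar>x - y\<bar> \<and> 0 \<le> x * (x - y))
      \<or> (a = 0 \<and> \<bar>y\<bar> \<le> C * \<bar>y - x\<bar> \<and> 0 \<le> y * (y - x))"
  shows "\<bar>a * x - b * y\<bar> powr p \<le> C powr p * (\<bar>x - y\<bar> powr (p - 2) * (x - y) * (a powr p * x - b powr p * y))"
proof -
  consider "a = b" | "x * y \<le> 0 \<or> (b = 0 \<and> \<bar>x\<bar> \<le> C * \<bar>x - y\<bar> \<and> 0 \<le> x * (x - y))"
    | "a = 0 \<and> \<bar>y\<bar> \<le> C * \<bar>y - x\<bar> \<and> 0 \<le> y * (y - x)"
    using cases by blast
  then show ?thesis
  proof cases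
    case 1
    have "\<bar>a * x - b * y\<bar> powr p = a powr p * \<bar>x - y\<bar> powr p"
      using 1 ab by (simp add: abs_mult powr_mult flip: right_diff_distrib)
    also have "\<dots> = a powr p * (\<bar>x - y\<bar> powr (p - 2) * (x - y) * (x - y))"
      by (simp only: signed_powr_mult)
    also have "\<dots> = \<bar>x - y\<bar> powr (p - 2) * (x - y) * (a powr p * x - b powr p * y)"
      using 1 by (simp add: algebra_simps)
    finally have eq: "\<bar>a * x - b * y\<bar> powr p = \<bar>x - y\<bar> powr (p - 2) * (x - y) * (a powr p * x - b powr p * y)" .
    have "1 \<le> C powr p" using C p by (simp add: ge_one_powr_ge_zero)
    then have "1 * \<bar>a * x - b * y\<bar> powr p \<le> C powr p * \<bar>a * x - b * y\<bar> powr p"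
      by (intro mult_right_mono) auto
    then show ?thesis using eq by simp
  next
    case 2
    then show ?thesis by (rule edge_inequality_zero_right[OF p ab C])
  next
    case 3
    then have "\<bar>b * y - a * x\<bar> powr p \<le> C powr p * (\<bar>y - x\<bar> powr (p - 2) * (y - x) * (b powr p * y - a powr p * x))"
      using ab by (intro edge_inequality_zero_right[OF p _ _ C]) auto
    then show ?thesis
      by (simp add: abs_minus_commute algebra_simps)
  qed
qed


context connected_weighted_graph
begin

lemma sum_edges_swap: "(\<Sum>(u, v)\<in>E. h u v) = (\<Sum>(u, v)\<in>E. h v u)"
proof (rule sum.reindex_bij_witness[where i = prod.swap and j = prod.swap])
  show "prod.swap e \<in> E" if "e \<in> E" for e
    using that sym_E by (cases e) (auto simp: sym_def)
  then show "prod.swap e \<in> E" if "e \<in> E" for e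
    using that .
qed auto

text \<open>
  The factor \<open>1/2\<close> in the norm is compensated by the edge occurring in both directions; a loop
  contributes nothing to either side.
\<close>
lemma edge_le_grad_norm:
  assumes p: "p > 0" and e: "(u, v) \<in> E"
  shows "w u v * \<bar>f $ v - f $ u\<bar> \<le> grad_norm E w p f"
proof (cases "u = v")
  case True
  then show ?thesis by (simp add: grad_norm_def)
next
  case False
  define h where "h = (\<lambda>(u, v). \<bar>w u v * (f $ v - f $ u)\<bar> powr p)"
  have e': "(v, u) \<in> E" using e sym_E by (auto simp: sym_def)
  have "h (v, u) = h (u, v)" using w_sym[OF e] by (simp add: h_def abs_mult abs_minus_commute)
  then have "2 * h (u, v) = sum h {(u, v), (v, u)}"
    using False by simp
  also have "\<dots> \<le> sum h E"
    using e e' by (intro sum_mono2) (auto simp: h_def)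
  finally have "h (u, v) powr (1 / p) \<le> (1 / 2 * sum h E) powr (1 / p)"
    using p by (intro powr_mono2) (auto simp: h_def)
  moreover have "h (u, v) powr (1 / p) = w u v * \<bar>f $ v - f $ u\<bar>"
    using p w_pos[OF e] by (simp add: h_def powr_powr abs_mult)
  ultimately show ?thesis by (simp add: grad_norm_def h_def)
qed

text \<open>
  The eigenvalue equation tested with \<open>a powr p * f\<close>. The flux \<open>D\<close> through an edge is antisymmetric, which
  turns the sum over nodes into half a sum over edges.
\<close>
lemma eigenfunction_energy:
  assumes eig: "eigenfunction E w B p l f" and p: "p > 1" and a: "\<And>u. u \<in> B \<Longrightarrow> a u = 0"
  shows "1 / 2 * (\<Sum>(u, v)\<in>E. w u v powr p * (\<bar>f $ u - f $ v\<bar> powr (p - 2) * (f $ u - f $ v) *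
      (a u powr p * f $ u - a v powr p * f $ v))) = l * (\<Sum>u\<in>UNIV. a u powr p * \<bar>f $ u\<bar> powr p)"
proof -
  define D where "D = (\<lambda>u v. w u v powr p * \<bar>f $ u - f $ v\<bar> powr (p - 2) * (f $ u - f $ v))"
  have D_anti: "D v u = - D u v" if "(u, v) \<in> E" for u v
    using w_sym[OF that] by (simp add: D_def abs_minus_commute algebra_simps)
  have "l * (\<Sum>u\<in>UNIV. a u powr p * \<bar>f $ u\<bar> powr p) = (\<Sum>u\<in>UNIV. a u powr p * f $ u * p_laplacian E w p f u)"
    unfolding sum_distrib_left
  proof (rule sum.cong)
    fix u
    show "l * (a u powr p * \<bar>f $ u\<bar> powr p) = a u powr p * f $ u * p_laplacian E w p f u"
    proof (cases "u \<in> B")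
      case True
      then show ?thesis using a by simp
    next
      case False
      then have "p_laplacian E w p f u = l * \<bar>f $ u\<bar> powr (p - 2) * f $ u"
        using eig by (simp add: eigenfunction_def)
      moreover have "\<bar>f $ u\<bar> powr p = \<bar>f $ u\<bar> powr (p - 2) * f $ u * f $ u"
        by (simp only: signed_powr_mult)
      ultimately show ?thesis by (simp only: mult_ac)
    qed
  qed simp
  also have "\<dots> = (\<Sum>u\<in>UNIV. \<Sum>v\<in>{v. (u, v) \<in> E}. D u v * (a u powr p * f $ u))"
    unfolding p_laplacian_def D_def by (simp add: sum_distrib_left mult_ac)
  also have "\<dots> = (\<Sum>(u, v)\<in>E. D u v * (a u powr p * f $ u))"
  proof -
    have "E = (SIGMA u:UNIV. {v. (u, v) \<in> E})" by auto
    then show ?thesis by (subst sum.Sigma) auto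
  qed
  finally have one: "l * (\<Sum>u\<in>UNIV. a u powr p * \<bar>f $ u\<bar> powr p) = (\<Sum>(u, v)\<in>E. D u v * (a u powr p * f $ u))" .
  also have "\<dots> = (\<Sum>(u, v)\<in>E. D v u * (a v powr p * f $ v))"
    by (rule sum_edges_swap)
  also have "\<dots> = (\<Sum>(u, v)\<in>E. - (D u v * (a v powr p * f $ v)))"
    by (rule sum.cong) (auto simp: D_anti)
  finally have two: "l * (\<Sum>u\<in>UNIV. a u powr p * \<bar>f $ u\<bar> powr p) = \<dots>" .
  have "(\<Sum>(u, v)\<in>E. w u v powr p * (\<bar>f $ u - f $ v\<bar> powr (p - 2) * (f $ u - f $ v) *
      (a u powr p * f $ u - a v powr p * f $ v))) =
      (\<Sum>(u, v)\<in>E. D u v * (a u powr p * f $ u) + - (D u v * (a v powr p * f $ v)))"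
    by (rule sum.cong) (auto simp: D_def algebra_simps)
  also have "\<dots> = (\<Sum>(u, v)\<in>E. D u v * (a u powr p * f $ u)) + (\<Sum>(u, v)\<in>E. - (D u v * (a v powr p * f $ v)))"
    by (simp only: case_prod_unfold sum.distrib)
  finally show ?thesis using one two by simp
qed

text \<open>
  For \<open>C = 1\<close> this says that rescaling on nodal domains does not raise the Rayleigh quotient above
  the eigenvalue. The factor \<open>C\<close> pays for the edges into nodes that are sent to \<open>0\<close> although \<open>f\<close> does
  not vanish there.
\<close>
lemma grad_norm_rescaled_eigenfunction:
  assumes eig: "eigenfunction E w B p l f" and p: "p > 1" and l: "l \<ge> 0"
    and a: "\<And>u. a u \<ge> 0" "\<And>u. u \<in> B \<Longrightarrow> a u = 0" and C: "C \<ge> 1"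
    and edges: "\<And>u v. (u, v) \<in> E \<Longrightarrow> a u = a v \<or> f $ u * f $ v \<le> 0 \<or>
      (a v = 0 \<and> \<bar>f $ u\<bar> \<le> C * \<bar>f $ u - f $ v\<bar> \<and> 0 \<le> f $ u * (f $ u - f $ v)) \<or>
      (a u = 0 \<and> \<bar>f $ v\<bar> \<le> C * \<bar>f $ v - f $ u\<bar> \<and> 0 \<le> f $ v * (f $ v - f $ u))"
  shows "grad_norm E w p (\<chi> u. a u * f $ u) \<le> C * l powr (1 / p) * p_norm p (\<chi> u. a u * f $ u)"
proof -
  let ?h = "\<chi> u. a u * f $ u"
  let ?R = "C * l powr (1 / p) * p_norm p ?h"
  have p0: "p > 0" using p by simp
  have "grad_norm E w p ?h powr p = 1 / 2 * (\<Sum>(u, v)\<in>E. \<bar>w u v * (?h $ v - ?h $ u)\<bar> powr p)"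
    by (rule grad_norm_powr[OF p0])
  also have "\<dots> \<le> 1 / 2 * (\<Sum>(u, v)\<in>E. C powr p * (w u v powr p * (\<bar>f $ u - f $ v\<bar> powr (p - 2) * (f $ u - f $ v) *
      (a u powr p * f $ u - a v powr p * f $ v))))"
  proof (intro mult_left_mono sum_mono, clarify)
    fix u v assume e: "(u, v) \<in> E"
    have "\<bar>w u v * (?h $ v - ?h $ u)\<bar> powr p = w u v powr p * \<bar>a u * f $ u - a v * f $ v\<bar> powr p"
      using w_pos[OF e] by (simp add: abs_mult powr_mult abs_minus_commute)
    also have "\<dots> \<le> w u v powr p * (C powr p * (\<bar>f $ u - f $ v\<bar> powr (p - 2) * (f $ u - f $ v) *
      (a u powr p * f $ u - a v powr p * f $ v)))"
      by (intro mult_left_mono edge_inequality[OF p a(1) a(1) C edges[OF e]]) simp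
    finally show "\<bar>w u v * (?h $ v - ?h $ u)\<bar> powr p \<le>
      C powr p * (w u v powr p * (\<bar>f $ u - f $ v\<bar> powr (p - 2) * (f $ u - f $ v) *
      (a u powr p * f $ u - a v powr p * f $ v)))"
      by (simp only: mult_ac)
  qed simp
  also have "\<dots> = C powr p * (1 / 2 * (\<Sum>(u, v)\<in>E. w u v powr p * (\<bar>f $ u - f $ v\<bar> powr (p - 2) * (f $ u - f $ v) *
      (a u powr p * f $ u - a v powr p * f $ v))))"
    by (simp add: case_prod_unfold sum_distrib_left mult_ac)
  also have "\<dots> = C powr p * (l * (\<Sum>u\<in>UNIV. a u powr p * \<bar>f $ u\<bar> powr p))"
    by (simp only: eigenfunction_energy[OF eig p a(2)])
  also have "(\<Sum>u\<in>UNIV. a u powr p * \<bar>f $ u\<bar> powr p) = p_norm p ?h powr p"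
    unfolding p_norm_powr[OF p0] using a(1) by (simp add: abs_mult powr_mult)
  also have "C powr p * (l * p_norm p ?h powr p) = ?R powr p"
    using C l p0 by (simp add: powr_mult powr_powr p_norm_def)
  finally have le: "grad_norm E w p ?h powr p \<le> ?R powr p" .
  have R: "0 \<le> ?R" using C l by (simp add: p_norm_def)
  show ?thesis
  proof (rule ccontr)
    assume "\<not> ?thesis"
    then have "?R powr p < grad_norm E w p ?h powr p"
      using R p0 by (intro powr_less_mono2) auto
    with le show False by simp
  qed
qed


section \<open>The limit of large exponents\<close>

text \<open>
  The factors \<open>a\<close> belong to the limit \<open>F\<close> but are applied to the eigenfunctions \<open>f j\<close>. For every
  \<open>C > 1\<close> the hypotheses on the edges in \<open>grad_norm_rescaled_eigenfunction\<close> hold for all large \<open>j\<close>, since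
  each of them follows from a strict inequality for \<open>F\<close> or from equality of the factors. A single edge
  difference is bounded by the gradient norm, and the \<open>p\<close>-norm by the maximum times
  \<open>CARD('v) powr (1/p)\<close>, which tends to \<open>1\<close>. This gives the bound \<open>C * C * \<Lambda>\<close>, and \<open>C\<close> tends to \<open>1\<close>.
\<close>
lemma limit_gradient_bound:
  assumes p: "\<And>j. 1 < p j" "filterlim p at_top sequentially"
    and eig: "\<And>j. eigenfunction E w B (p j) (l j) (f j)" and l: "\<And>j. 0 \<le> l j"
    and f_lim: "f \<longlonglongrightarrow> F" and l_lim: "(\<lambda>j. l j powr (1 / p j)) \<longlonglongrightarrow> \<Lambda>"
    and a: "\<And>u. a u \<ge> 0" "\<And>u. F $ u = 0 \<Longrightarrow> a u = 0"
      "\<And>u v. (u, v) \<in> E \<Longrightarrow> 0 < F $ u * F $ v \<Longrightarrow> a u = a v" "\<And>u. \<bar>a u * F $ u\<bar> \<le> 1"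
    and e: "(x, y) \<in> E"
  shows "w x y * \<bar>a y * F $ y - a x * F $ x\<bar> \<le> \<Lambda>"
proof -
  have comp: "(\<lambda>j. f j $ u) \<longlonglongrightarrow> F $ u" for u
    by (intro tendsto_vec_nth f_lim)
  have F_H0: "F \<in> H0 B"
    using closed_sequentially[OF closed_H0 _ f_lim] eig by (auto simp: eigenfunction_def)
  have bound: "w x y * \<bar>a y * F $ y - a x * F $ x\<bar> \<le> C * \<Lambda> * (1 * C)" if C: "C > 1" for C
  proof -
    define good where "good = (\<lambda>j u v. a u = a v \<or> f j $ u * f j $ v \<le> 0 \<or>
      (a v = 0 \<and> \<bar>f j $ u\<bar> \<le> C * \<bar>f j $ u - f j $ v\<bar> \<and> 0 \<le> f j $ u * (f j $ u - f j $ v)) \<or>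
      (a u = 0 \<and> \<bar>f j $ v\<bar> \<le> C * \<bar>f j $ v - f j $ u\<bar> \<and> 0 \<le> f j $ v * (f j $ v - f j $ u)))"
    have leave: "\<forall>\<^sub>F j in sequentially. \<bar>f j $ u\<bar> \<le> C * \<bar>f j $ u - f j $ v\<bar> \<and> 0 \<le> f j $ u * (f j $ u - f j $ v)"
      if "F $ u \<noteq> 0" "F $ v = 0" for u v
    proof -
      have "(\<lambda>j. C * \<bar>f j $ u - f j $ v\<bar> - \<bar>f j $ u\<bar>) \<longlonglongrightarrow> C * \<bar>F $ u - F $ v\<bar> - \<bar>F $ u\<bar>"
        by (intro tendsto_intros comp)
      moreover have "0 < C * \<bar>F $ u - F $ v\<bar> - \<bar>F $ u\<bar>"
        using that C by simp
      ultimately have 1: "\<forall>\<^sub>F j in sequentially. 0 < C * \<bar>f j $ u - f j $ v\<bar> - \<bar>f j $ u\<bar>"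
        by (rule order_tendstoD)
      have "(\<lambda>j. f j $ u * (f j $ u - f j $ v)) \<longlonglongrightarrow> F $ u * (F $ u - F $ v)"
        by (intro tendsto_intros comp)
      moreover have "0 < F $ u * (F $ u - F $ v)"
        using that by (metis diff_zero not_real_square_gt_zero)
      ultimately have "\<forall>\<^sub>F j in sequentially. 0 < f j $ u * (f j $ u - f j $ v)"
        by (rule order_tendstoD)
      with 1 show ?thesis by eventually_elim auto
    qed
    have "\<forall>\<^sub>F j in sequentially. good j u v" if e: "(u, v) \<in> E" for u v
    proof -
      consider "a u = a v" | "F $ u * F $ v < 0" | "F $ u \<noteq> 0" "F $ v = 0" | "F $ v \<noteq> 0" "F $ u = 0"
        using a(2)[of u] a(2)[of v] a(3)[OF e] by (metis linorder_cases mult_eq_0_iff)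
      then show ?thesis
      proof cases
        case 1
        then show ?thesis by (simp add: good_def)
      next
        case 2
        have "(\<lambda>j. f j $ u * f j $ v) \<longlonglongrightarrow> F $ u * F $ v"
          by (intro tendsto_intros comp)
        from order_tendstoD(2)[OF this 2] show ?thesis
          by eventually_elim (simp add: good_def)
      next
        case 3
        from leave[OF 3] show ?thesis
          by eventually_elim (simp add: good_def a(2)[OF 3(2)])
      next
        case 4
        from leave[OF 4] show ?thesis
          by eventually_elim (simp add: good_def a(2)[OF 4(2)])
      qed
    qed
    then have "\<forall>\<^sub>F j in sequentially. \<forall>z\<in>E. good j (fst z) (snd z)"
      by (intro eventually_ball_finite) auto
    moreover have "\<forall>\<^sub>F j in sequentially. \<bar>a u * f j $ u\<bar> < C" for u
    proof (rule order_tendstoD(2))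
      show "(\<lambda>j. \<bar>a u * f j $ u\<bar>) \<longlonglongrightarrow> \<bar>a u * F $ u\<bar>"
        by (intro tendsto_intros comp)
    qed (use a(4)[of u] C in simp)
    then have "\<forall>\<^sub>F j in sequentially. \<forall>u. \<bar>a u * f j $ u\<bar> < C"
      by (intro eventually_all_finite)
    ultimately have ev: "\<forall>\<^sub>F j in sequentially. w x y * \<bar>a y * f j $ y - a x * f j $ x\<bar> \<le>
      C * l j powr (1 / p j) * (real CARD('v) powr (1 / p j) * C)"
    proof eventually_elim
      case (elim j)
      let ?h = "\<chi> u. a u * f j $ u"
      have p0: "p j > 0" using p(1)[of j] by simp
      have "w x y * \<bar>a y * f j $ y - a x * f j $ x\<bar> = w x y * \<bar>?h $ y - ?h $ x\<bar>"
        by simp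
      also have "\<dots> \<le> grad_norm E w (p j) ?h"
        by (rule edge_le_grad_norm[OF p0 e])
      also have "\<dots> \<le> C * l j powr (1 / p j) * p_norm (p j) ?h"
      proof (rule grad_norm_rescaled_eigenfunction[OF eig p(1) l a(1)])
        show "a u = 0" if "u \<in> B" for u using a(2) F_H0 that by (simp add: H0_def)
      next
        fix u v assume "(u, v) \<in> E"
        with elim(1) have "good j u v" by force
        then show "a u = a v \<or> f j $ u * f j $ v \<le> 0 \<or>
          (a v = 0 \<and> \<bar>f j $ u\<bar> \<le> C * \<bar>f j $ u - f j $ v\<bar> \<and> 0 \<le> f j $ u * (f j $ u - f j $ v)) \<or>
          (a u = 0 \<and> \<bar>f j $ v\<bar> \<le> C * \<bar>f j $ v - f j $ u\<bar> \<and> 0 \<le> f j $ v * (f j $ v - f j $ u))"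
          unfolding good_def .
      qed (use C in simp)
      also have "\<dots> \<le> C * l j powr (1 / p j) * (real CARD('v) powr (1 / p j) * C)"
        using elim(2) C by (intro mult_left_mono p_norm_le[OF p0]) (auto intro: less_imp_le)
      finally show ?case .
    qed
    have "(\<lambda>j. 1 / p j) \<longlonglongrightarrow> 0"
      using tendsto_inverse_0_at_top[OF p(2)] by (simp add: inverse_eq_divide)
    then have "(\<lambda>j. real CARD('v) powr (1 / p j)) \<longlonglongrightarrow> real CARD('v) powr 0"
      by (intro tendsto_powr tendsto_const) auto
    then have card_lim: "(\<lambda>j. real CARD('v) powr (1 / p j)) \<longlonglongrightarrow> 1" by simp
    show ?thesis
    proof (rule tendsto_le[OF sequentially_bot _ _ ev])
      show "(\<lambda>j. C * l j powr (1 / p j) * (real CARD('v) powr (1 / p j) * C)) \<longlonglongrightarrow> C * \<Lambda> * (1 * C)"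
        by (intro tendsto_mult tendsto_const l_lim card_lim)
      show "(\<lambda>j. w x y * \<bar>a y * f j $ y - a x * f j $ x\<bar>) \<longlonglongrightarrow> w x y * \<bar>a y * F $ y - a x * F $ x\<bar>"
        by (intro tendsto_intros comp)
    qed
  qed
  have "((\<lambda>C. C * \<Lambda> * (1 * C)) \<longlongrightarrow> 1 * \<Lambda> * (1 * 1)) (at_right 1)"
    by (intro tendsto_intros)
  moreover have "\<forall>\<^sub>F C in at_right 1. w x y * \<bar>a y * F $ y - a x * F $ x\<bar> \<le> C * \<Lambda> * (1 * C)"
    using bound by (simp add: eventually_at_filter)
  ultimately have "w x y * \<bar>a y * F $ y - a x * F $ x\<bar> \<le> 1 * \<Lambda> * (1 * 1)"
    by (rule tendsto_lowerbound) simp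
  then show ?thesis by simp
qed

text \<open>
  Raising the constant \<open>card E / 2\<close> by \<open>1\<close> makes its \<open>p\<close>-th root tend to \<open>1\<close> even for a graph without
  edges.
\<close>
lemma limit_eigenvalue_le_packing:
  assumes p: "\<And>j. 1 < p j" "filterlim p at_top sequentially" and k: "1 \<le> k" "k \<le> CARD('v)"
    and lim: "(\<lambda>j. variational_eigenvalue E w B (p j) k powr (1 / p j)) \<longlonglongrightarrow> \<Lambda>"
    and r: "r > 0" and pack: "packing k r u"
  shows "\<Lambda> \<le> 1 / r"
proof -
  let ?c = "real (card E) / 2 + 1"
  have "variational_eigenvalue E w B (p j) k powr (1 / p j) \<le> ?c powr (1 / p j) * (1 / r)" for j
  proof -
    note le = variational_eigenvalue_le_packing[OF p(1) k r pack, of j]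
    have "variational_eigenvalue E w B (p j) k \<le> ?c * (1 / r) powr p j"
      using le(2) by (rule order_trans) (intro mult_right_mono; simp)
    then have "variational_eigenvalue E w B (p j) k powr (1 / p j) \<le> (?c * (1 / r) powr p j) powr (1 / p j)"
      using le(1) p(1)[of j] by (intro powr_mono2) auto
    also have "\<dots> = ?c powr (1 / p j) * (1 / r)"
      using p(1)[of j] r by (simp add: powr_mult powr_powr)
    finally show ?thesis .
  qed
  moreover have "(\<lambda>j. 1 / p j) \<longlonglongrightarrow> 0"
    using tendsto_inverse_0_at_top[OF p(2)] by (simp add: inverse_eq_divide)
  then have "(\<lambda>j. ?c powr (1 / p j) * (1 / r)) \<longlonglongrightarrow> ?c powr 0 * (1 / r)"
    by (intro tendsto_mult tendsto_powr tendsto_const) auto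
  ultimately have "\<Lambda> \<le> ?c powr 0 * (1 / r)"
    using lim by (intro LIMSEQ_le[of _ \<Lambda>]) auto
  then show ?thesis by (simp split: if_splits)
qed

lemma packing_radius_ge: "r > 0 \<Longrightarrow> packing m r u \<Longrightarrow> ereal r \<le> packing_radius E w B m"
  unfolding packing_radius_eq by (intro Sup_upper) blast

lemma inverse_packing_radius_le:
  assumes "\<Lambda> \<ge> 0" and pack: "\<And>r. r > 0 \<Longrightarrow> r * \<Lambda> \<le> 1 \<Longrightarrow> \<exists>u. packing m r u"
  shows "1 / packing_radius E w B m \<le> ereal \<Lambda>"
proof -
  have le: "ereal r \<le> packing_radius E w B m" if "r > 0" "r * \<Lambda> \<le> 1" for r
    using pack[OF that] packing_radius_ge that by blast
  show ?thesis
  proof (cases "\<Lambda> = 0")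
    case True
    have "packing_radius E w B m = \<infinity>"
    proof (rule ereal_top)
      fix b :: real
      show "ereal b \<le> packing_radius E w B m"
      proof (rule order_trans)
        show "ereal b \<le> ereal (max b 1)" by simp
        show "ereal (max b 1) \<le> packing_radius E w B m"
          using True by (intro le) auto
      qed
    qed
    then show ?thesis using True by simp
  next
    case False
    with assms(1) have pos: "\<Lambda> > 0" by simp
    then have "ereal (1 / \<Lambda>) \<le> packing_radius E w B m" by (intro le) auto
    then show ?thesis
    proof (cases "packing_radius E w B m")
      case (real R)
      with \<open>ereal (1 / \<Lambda>) \<le> _\<close> have R: "1 / \<Lambda> \<le> R" by simp
      moreover have "0 < 1 / \<Lambda>" using pos by simp
      ultimately have "R > 0" by linarith
      then have "1 / R \<le> \<Lambda>" using pos R by (simp add: field_simps)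
      then show ?thesis using real \<open>R > 0\<close> by (simp add: one_ereal_def)
    qed (use pos in auto)
  qed
qed

text \<open>
  Existence of one packing excludes that the supremum is taken over the empty set, in which case
  the right-hand side would be \<open>0\<close>.
\<close>
lemma le_inverse_packing_radius:
  assumes "\<Lambda> \<ge> 0" and ex: "\<exists>r>0. \<exists>u. packing m r u"
    and pack: "\<And>r u. r > 0 \<Longrightarrow> packing m r u \<Longrightarrow> \<Lambda> \<le> 1 / r"
  shows "ereal \<Lambda> \<le> 1 / packing_radius E w B m"
proof -
  obtain r0 where r0: "r0 > 0" "ereal r0 \<le> packing_radius E w B m"
    using ex packing_radius_ge by blast
  show ?thesis
  proof (cases "\<Lambda> = 0")
    case True
    then show ?thesis
      using r0 by (cases "packing_radius E w B m") (auto simp: one_ereal_def)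
  next
    case False
    with assms(1) have pos: "\<Lambda> > 0" by simp
    have "packing_radius E w B m \<le> ereal (1 / \<Lambda>)"
      unfolding packing_radius_eq
    proof (rule Sup_least, clarify)
      fix r u assume "0 < r" "packing m r u"
      from pack[OF this] show "ereal r \<le> ereal (1 / \<Lambda>)"
        using pos \<open>0 < r\<close> by (simp add: field_simps)
    qed
    then obtain R where R: "packing_radius E w B m = ereal R" "r0 \<le> R" "R \<le> 1 / \<Lambda>"
      using r0 by (cases "packing_radius E w B m") auto
    then have "\<Lambda> \<le> 1 / R" using pos r0 by (simp add: field_simps)
    then show ?thesis using R r0 by (simp add: one_ereal_def)
  qed
qed

end

theorem corollary3p11:
  fixes E :: "('v::finite \<times> 'v) set" and w :: "'v \<Rightarrow> 'v \<Rightarrow> real" and B :: "'v set"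
    and k :: nat and p :: "nat \<Rightarrow> real"
    and f :: "nat \<Rightarrow> real ^ 'v" and f\<^sub>k :: "real ^ 'v" and \<Lambda>\<^sub>k :: real
  assumes "connected_weighted_graph E w B"
    and "1 \<le> k" and "k \<le> card (- B)"
    and "\<And>j. 1 < p j" and "filterlim p at_top sequentially"
    and "\<And>j. eigenfunction E w B (p j) (variational_eigenvalue E w B (p j) k) (f j)"
    and "(\<lambda>j. (f j, variational_eigenvalue E w B (p j) k powr (1 / p j))) \<longlonglongrightarrow> (f\<^sub>k, \<Lambda>\<^sub>k)"
    and "f\<^sub>k \<noteq> 0"
  shows "1 / packing_radius E w B (card (nodal_domains E f\<^sub>k)) \<le> ereal \<Lambda>\<^sub>k
    \<and> ereal \<Lambda>\<^sub>k \<le> 1 / packing_radius E w B k"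
proof -
  interpret connected_weighted_graph E w B by fact
  let ?l = "\<lambda>j. variational_eigenvalue E w B (p j) k"
  have f_lim: "f \<longlonglongrightarrow> f\<^sub>k" and l_lim: "(\<lambda>j. ?l j powr (1 / p j)) \<longlonglongrightarrow> \<Lambda>\<^sub>k"
    using tendsto_fst[OF assms(7)] tendsto_snd[OF assms(7)] by simp_all
  have k: "k \<le> CARD('v)"
    using assms(3) card_mono[of "UNIV :: 'v set" "- B"] by simp
  have ex: "\<exists>r>0. \<exists>u. packing k r u"
    by (rule packing_exists[OF assms(3)])
  then obtain r u where "r > 0" "packing k r u" by blast
  then have l: "0 \<le> ?l j" for j
    using variational_eigenvalue_le_packing(1)[OF assms(4) assms(2) k] by blast
  have \<Lambda>: "0 \<le> \<Lambda>\<^sub>k"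
    by (rule tendsto_lowerbound[OF l_lim]) auto
  have H0: "f\<^sub>k \<in> H0 B"
    using closed_sequentially[OF closed_H0 _ f_lim] assms(6) by (auto simp: eigenfunction_def)
  obtain a where a: "\<And>u. a u \<ge> 0" "\<And>u. f\<^sub>k $ u = 0 \<Longrightarrow> a u = 0"
    "\<And>u v. (u, v) \<in> E \<Longrightarrow> 0 < f\<^sub>k $ u * f\<^sub>k $ v \<Longrightarrow> a u = a v"
    "\<And>u. \<bar>a u * f\<^sub>k $ u\<bar> \<le> 1"
    "\<And>U. U \<in> nodal_domains E f\<^sub>k \<Longrightarrow> \<exists>u\<in>U. \<bar>a u * f\<^sub>k $ u\<bar> = 1"
    using nodal_normalization[OF sym_E] by blast
  have lip: "w u v * \<bar>a v * f\<^sub>k $ v - a u * f\<^sub>k $ u\<bar> \<le> \<Lambda>\<^sub>k" if "(u, v) \<in> E" for u v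
    by (rule limit_gradient_bound[OF assms(4,5,6) l f_lim l_lim a(1-4) that])
  have "1 / packing_radius E w B (card (nodal_domains E f\<^sub>k)) \<le> ereal \<Lambda>\<^sub>k"
    by (rule inverse_packing_radius_le[OF \<Lambda> packing_nodal_domains[OF H0 a(1,5) lip]])
  moreover have "ereal \<Lambda>\<^sub>k \<le> 1 / packing_radius E w B k"
    by (rule le_inverse_packing_radius[OF \<Lambda> ex limit_eigenvalue_le_packing[OF assms(4,5,2) k l_lim]])
  ultimately show ?thesis ..
qed

end
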